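(* Let $p$ be a prime number, let $F$ be a field of characteristic $p$, and let $A$ be a tensor product over $F$ of $n\geq 1$ cyclic $p$-algebras. Then there exist $a_0,\dots,a_n\in F^\times$ such that \[A\simeq[a_0,a_1)_{p,F}\otimes_F[a_1,a_2)_{p,F}\otimes_F\dots\otimes_F[a_{n-1},a_n)_{p,F}.\]
   Context: For a field $F$ of characteristic $p>0$, $\alpha\in F$ and $\beta\in F^\times$, $[\alpha,\beta)_{p,F}$ denotes the cyclic $p$-algebra, i.e. the $F$-algebra (central simple of degree $p$) generated by two elements $i,j$ subject to the relations $i^p-i=\alpha$, $j^p=\beta$ and $jij^{-1}=i-1$. A cyclic $p$-algebra over $F$ is an algebra isomorphic to some $[\alpha,\beta)_{p,F}$. *)

theory Defs
  imports "HOL-Algebra.Algebra"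
begin

text \<open>The characteristic of a ring: the additive order of its one (0 if that order is infinite).\<close>

definition ring_char :: "('f, 'm) ring_scheme \<Rightarrow> nat" where
  "ring_char F = group.ord (add_monoid F) \<one>\<^bsub>F\<^esub>"

text \<open>
  Associative unital algebras, not necessarily commutative; the locale \<^locale>\<open>algebra\<close> of
  HOL-Algebra only covers commutative ones.
\<close>

locale assoc_algebra = module F A + ring A for F (structure) and A (structure) +
  assumes smult_mult_left:
      "\<lbrakk>c \<in> carrier F; x \<in> carrier A; y \<in> carrier A\<rbrakk> \<Longrightarrow>
       (c \<odot>\<^bsub>A\<^esub> x) \<otimes>\<^bsub>A\<^esub> y = c \<odot>\<^bsub>A\<^esub> (x \<otimes>\<^bsub>A\<^esub> y)"
    and smult_mult_right:
      "\<lbrakk>c \<in> carrier F; x \<in> carrier A; y \<in> carrier A\<rbrakk> \<Longrightarrow>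
       x \<otimes>\<^bsub>A\<^esub> (c \<odot>\<^bsub>A\<^esub> y) = c \<odot>\<^bsub>A\<^esub> (x \<otimes>\<^bsub>A\<^esub> y)"

definition alg_iso ::
  "('f, 'm) ring_scheme \<Rightarrow> ('f, 'a, 'k) module_scheme \<Rightarrow> ('f, 'b, 'l) module_scheme \<Rightarrow> bool" where
  "alg_iso F A B \<longleftrightarrow>
     (\<exists>h \<in> ring_iso A B. \<forall>c \<in> carrier F. \<forall>x \<in> carrier A. h (c \<odot>\<^bsub>A\<^esub> x) = c \<odot>\<^bsub>B\<^esub> h x)"

text \<open>
  The monoid algebra \<open>F[M]\<close>: finitely supported functions from the carrier of \<open>M\<close> to \<open>F\<close>
  (extended by zero outside the carrier) with the convolution product. As an \<open>F\<close>-module it is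
  the free module on the carrier of \<open>M\<close>, with basis the functions \<open>basis_elt F x\<close>.
\<close>

definition monoid_algebra ::
  "('f, 'm) ring_scheme \<Rightarrow> ('x, 'k) monoid_scheme \<Rightarrow> ('f, 'x \<Rightarrow> 'f) module" where
  "monoid_algebra F M =
     \<lparr>carrier = {f. (\<forall>x. f x \<in> carrier F) \<and> {x. f x \<noteq> \<zero>\<^bsub>F\<^esub>} \<subseteq> carrier M \<and>
                    finite {x. f x \<noteq> \<zero>\<^bsub>F\<^esub>}},
      monoid.mult = (\<lambda>f g z. finsum F (\<lambda>(x, y). f x \<otimes>\<^bsub>F\<^esub> g y)
                {(x, y). f x \<noteq> \<zero>\<^bsub>F\<^esub> \<and> g y \<noteq> \<zero>\<^bsub>F\<^esub> \<and> x \<otimes>\<^bsub>M\<^esub> y = z}),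
      monoid.one = (\<lambda>x. if x = \<one>\<^bsub>M\<^esub> then \<one>\<^bsub>F\<^esub> else \<zero>\<^bsub>F\<^esub>),
      ring.zero = (\<lambda>x. \<zero>\<^bsub>F\<^esub>),
      ring.add = (\<lambda>f g x. f x \<oplus>\<^bsub>F\<^esub> g x),
      module.smult = (\<lambda>c f x. c \<otimes>\<^bsub>F\<^esub> f x)\<rparr>"

definition basis_elt :: "('f, 'm) ring_scheme \<Rightarrow> 'x \<Rightarrow> 'x \<Rightarrow> 'f" where
  "basis_elt F x = (\<lambda>y. if y = x then \<one>\<^bsub>F\<^esub> else \<zero>\<^bsub>F\<^esub>)"

text \<open>
  The quotient of an algebra by a two-sided ideal. An ideal of a unital algebra is automatically
  a subspace, so the scalar multiplication of cosets is well defined.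
\<close>

definition alg_quot :: "('f, 'a, 'm) module_scheme \<Rightarrow> 'a set \<Rightarrow> ('f, 'a set) module" where
  "alg_quot A J =
     \<lparr>carrier = carrier (A Quot J),
      monoid.mult = monoid.mult (A Quot J),
      monoid.one = monoid.one (A Quot J),
      ring.zero = ring.zero (A Quot J),
      ring.add = ring.add (A Quot J),
      module.smult = (\<lambda>c Y. \<Union>y\<in>Y. J +>\<^bsub>A\<^esub> (c \<odot>\<^bsub>A\<^esub> y))\<rparr>"

definition free_algebra :: "('f, 'm) ring_scheme \<Rightarrow> ('f, 'g list \<Rightarrow> 'f) module" where
  "free_algebra F = monoid_algebra F \<lparr>carrier = UNIV, monoid.mult = (@), one = []\<rparr>"

datatype cyc_gen = GenI | GenJ

text \<open>
  The algebra \<open>[\<alpha>,\<beta>)\<close> over \<open>F\<close>, presented by \<open>i\<close> and \<open>j\<close>. Since \<open>\<beta>\<close> is a unit, \<open>j ^ p = \<beta>\<close> makes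
  \<open>j\<close> invertible, and so the relation \<open>j i j\<inverse> = i - 1\<close> can be written as \<open>j i = (i - 1) j\<close>.
\<close>

definition cyclic_relators ::
  "nat \<Rightarrow> ('f, 'm) ring_scheme \<Rightarrow> 'f \<Rightarrow> 'f \<Rightarrow> (cyc_gen list \<Rightarrow> 'f) set" where
  "cyclic_relators p F \<alpha> \<beta> =
     (let R = free_algebra F; i = basis_elt F [GenI]; j = basis_elt F [GenJ] in
       {(i [^]\<^bsub>R\<^esub> p \<ominus>\<^bsub>R\<^esub> i) \<ominus>\<^bsub>R\<^esub> \<alpha> \<odot>\<^bsub>R\<^esub> \<one>\<^bsub>R\<^esub>,
        j [^]\<^bsub>R\<^esub> p \<ominus>\<^bsub>R\<^esub> \<beta> \<odot>\<^bsub>R\<^esub> \<one>\<^bsub>R\<^esub>,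
        j \<otimes>\<^bsub>R\<^esub> i \<ominus>\<^bsub>R\<^esub> (i \<ominus>\<^bsub>R\<^esub> \<one>\<^bsub>R\<^esub>) \<otimes>\<^bsub>R\<^esub> j})"

definition cyclic_alg ::
  "nat \<Rightarrow> ('f, 'm) ring_scheme \<Rightarrow> 'f \<Rightarrow> 'f \<Rightarrow> ('f, (cyc_gen list \<Rightarrow> 'f) set) module" where
  "cyclic_alg p F \<alpha> \<beta> =
     alg_quot (free_algebra F) (Idl\<^bsub>free_algebra F\<^esub> (cyclic_relators p F \<alpha> \<beta>))"

definition cyclic_p_algebra ::
  "nat \<Rightarrow> ('f, 'm) ring_scheme \<Rightarrow> ('f, 'a, 'k) module_scheme \<Rightarrow> bool" where
  "cyclic_p_algebra p F B \<longleftrightarrow> assoc_algebra F B \<and>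
     (\<exists>\<alpha> \<in> carrier F. \<exists>\<beta> \<in> carrier F - {\<zero>\<^bsub>F\<^esub>}. alg_iso F B (cyclic_alg p F \<alpha> \<beta>))"

text \<open>
  The tensor product over \<open>F\<close> of a finite family of algebras \<open>B k\<close>, \<open>k \<in> K\<close>: the free module on
  the product of the carriers modulo the multilinearity relations, where pure tensors (the classes
  of basis elements) multiply componentwise. The free module with this multiplication is the monoid
  algebra of the product of the multiplicative monoids. A product of a relator and a basis element
  is again a relator, so the subspace spanned by the relators is the two-sided ideal they generate.
\<close>

definition tensor_relators ::
  "('f, 'm) ring_scheme \<Rightarrow> 'i set \<Rightarrow> ('i \<Rightarrow> ('f, 'a, 'k) module_scheme) \<Rightarrow>
   (('i \<Rightarrow> 'a) \<Rightarrow> 'f) set" where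
  "tensor_relators F K B =
     (let R = monoid_algebra F (product_group K B) in
       {basis_elt F (x(k := a \<oplus>\<^bsub>B k\<^esub> b)) \<ominus>\<^bsub>R\<^esub>
          (basis_elt F (x(k := a)) \<oplus>\<^bsub>R\<^esub> basis_elt F (x(k := b))) | x k a b.
          x \<in> (\<Pi>\<^sub>E k\<in>K. carrier (B k)) \<and> k \<in> K \<and> a \<in> carrier (B k) \<and> b \<in> carrier (B k)} \<union>
       {basis_elt F (x(k := c \<odot>\<^bsub>B k\<^esub> a)) \<ominus>\<^bsub>R\<^esub> c \<odot>\<^bsub>R\<^esub> basis_elt F (x(k := a)) | x k c a.
          x \<in> (\<Pi>\<^sub>E k\<in>K. carrier (B k)) \<and> k \<in> K \<and> c \<in> carrier F \<and> a \<in> carrier (B k)})"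

definition tensor_alg ::
  "('f, 'm) ring_scheme \<Rightarrow> 'i set \<Rightarrow> ('i \<Rightarrow> ('f, 'a, 'k) module_scheme) \<Rightarrow>
   ('f, (('i \<Rightarrow> 'a) \<Rightarrow> 'f) set) module" where
  "tensor_alg F K B =
     (let R = monoid_algebra F (product_group K B) in
       alg_quot R (Idl\<^bsub>R\<^esub> (tensor_relators F K B)))"

end

theory Submission
  imports Defs "HOL-Computational_Algebra.Polynomial" "HOL-Number_Theory.Residues"
begin

text \<open>
  No interaction between the tensor factors is needed: it suffices to change the presentation of
  each factor. The chain is built from the right. If \<open>[\<gamma>, \<delta>)\<close> is to be put in front of a chain
  starting with \<open>[a, b)\<close>, one may replace \<open>a\<close> by \<open>a + \<lambda>\<^sup>p - \<lambda>\<close>, \<open>\<gamma>\<close> by \<open>\<gamma> + c\<^sup>p \<delta>\<^sup>p\<^sup>-\<^sup>1\<close> (the generator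
  \<open>i\<close> becomes \<open>i + c j\<^sup>p\<^sup>-\<^sup>1\<close>), and \<open>\<delta>\<close> by \<open>\<gamma>\<delta>\<close> if \<open>\<gamma> \<noteq> 0\<close> (\<open>j\<close> becomes \<open>i j\<close>). Taking
  \<open>\<lambda> = c\<delta> = a - \<gamma>\<delta>\<close> makes the new \<open>\<delta>\<close> and the new \<open>a\<close> coincide. If this common value vanishes,
  then \<open>[\<gamma>, \<delta>)\<close> is isomorphic to \<open>[0, \<delta>)\<close>, hence split, hence isomorphic to \<open>[a\<inverse>, a)\<close>.
\<close>

section \<open>Monoid algebras\<close>

text \<open>Every isomorphism between cyclic algebras is obtained by finding, in each of two
  presented algebras, elements that satisfy the relations of the other. The two homomorphisms so
  defined are mutually inverse as soon as they are so on generators. The obstacle is to compute p-th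
  powers in a noncommutative ring: for \<open>y x = (x - 1) y\<close> neither
  \<open>(x + c y^(p-1))^p\<close> nor \<open>(x y)^p\<close> expands by the usual binomial theorem.
  The way out is the congruence X^p - X = X(X-1)...(X-p+1) modulo p. Moving a power of
  \<open>y\<close> past \<open>x\<close> shifts \<open>x\<close> by an integer, so falling
  factorials obey simple one-step recursions where powers do not. The direction of the induction
  matters: an inner entry of a chain is the second slot of one factor and the first slot of the
  next, while the head of a chain lies in a single slot and can still be changed freely when a
  factor is put in front.\<close>

locale cring_monoid = F: cring F + M: monoid M for F (structure) and M (structure)
begin

abbreviation MA where "MA \<equiv> monoid_algebra F M"

definition supp :: "('c \<Rightarrow> 'a) \<Rightarrow> 'c set" where
  "supp f = {x. f x \<noteq> \<zero>\<^bsub>F\<^esub>}"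

lemma MA_carrier: "f \<in> carrier MA \<longleftrightarrow>
    (\<forall>x. f x \<in> carrier F) \<and> supp f \<subseteq> carrier M \<and> finite (supp f)"
  by (simp add: monoid_algebra_def supp_def)

lemma MA_closed [simp]: "f \<in> carrier MA \<Longrightarrow> f x \<in> carrier F"
  by (simp add: MA_carrier)

lemma MA_zero: "\<zero>\<^bsub>MA\<^esub> = (\<lambda>x. \<zero>\<^bsub>F\<^esub>)"
  and MA_one: "\<one>\<^bsub>MA\<^esub> = basis_elt F \<one>\<^bsub>M\<^esub>"
  and MA_add: "f \<oplus>\<^bsub>MA\<^esub> g = (\<lambda>x. f x \<oplus>\<^bsub>F\<^esub> g x)"
  and MA_smult: "c \<odot>\<^bsub>MA\<^esub> f = (\<lambda>x. c \<otimes>\<^bsub>F\<^esub> f x)"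
  unfolding monoid_algebra_def basis_elt_def monoid.simps ring.simps module.simps by (rule refl)+

text \<open>The defining sum runs over an index set that depends on \<open>f\<close>,
  \<open>g\<close> and \<open>z\<close>. Here the condition moves into the summand and the index set
  is any finite rectangle containing the supports, so that sums for different functions can be
  compared term by term.\<close>

lemma MA_mult:
  assumes f: "f \<in> carrier MA" and g: "g \<in> carrier MA"
    and S: "finite S" "supp f \<subseteq> S" and T: "finite T" "supp g \<subseteq> T"
  shows "(f \<otimes>\<^bsub>MA\<^esub> g) z =
    (\<Oplus>\<^bsub>F\<^esub>q\<in>S \<times> T. if fst q \<otimes>\<^bsub>M\<^esub> snd q = z then f (fst q) \<otimes>\<^bsub>F\<^esub> g (snd q) else \<zero>\<^bsub>F\<^esub>)"
proof -
  have [simp]: "\<And>x. f x \<in> carrier F" "\<And>x. g x \<in> carrier F"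
    using f g by auto
  show ?thesis
    unfolding monoid_algebra_def monoid.simps
  proof (rule F.add.finprod_mono_neutral_cong_left)
    show "finite (S \<times> T)" using S T by simp
    show "{(x, y). f x \<noteq> \<zero>\<^bsub>F\<^esub> \<and> g y \<noteq> \<zero>\<^bsub>F\<^esub> \<and> x \<otimes>\<^bsub>M\<^esub> y = z} \<subseteq> S \<times> T"
      using S T by (auto simp: supp_def)
  qed (auto split: if_splits)
qed

lemma MA_zero_closed: "\<zero>\<^bsub>MA\<^esub> \<in> carrier MA"
  by (simp add: MA_carrier MA_zero supp_def)

lemma MA_basis_closed [simp]: "x \<in> carrier M \<Longrightarrow> basis_elt F x \<in> carrier MA"
proof -
  assume "x \<in> carrier M"
  moreover have "supp (basis_elt F x) \<subseteq> {x}"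
    by (auto simp: supp_def basis_elt_def)
  ultimately show ?thesis
    by (auto simp: MA_carrier basis_elt_def intro: finite_subset)
qed

lemma MA_add_closed:
  assumes "f \<in> carrier MA" "g \<in> carrier MA" shows "f \<oplus>\<^bsub>MA\<^esub> g \<in> carrier MA"
proof -
  have "supp (f \<oplus>\<^bsub>MA\<^esub> g) \<subseteq> supp f \<union> supp g"
    by (auto simp: MA_add supp_def)
  then show ?thesis
    using assms unfolding MA_carrier
    by (auto simp: MA_add dest: finite_subset)
qed

lemma MA_smult_closed:
  assumes "c \<in> carrier F" "f \<in> carrier MA" shows "c \<odot>\<^bsub>MA\<^esub> f \<in> carrier MA"
proof -
  have "supp (c \<odot>\<^bsub>MA\<^esub> f) \<subseteq> supp f"
    using assms(1) by (auto simp: MA_smult supp_def)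
  then show ?thesis
    using assms unfolding MA_carrier
    by (auto simp: MA_smult dest: finite_subset)
qed

lemma MA_mult_closed:
  assumes f: "f \<in> carrier MA" and g: "g \<in> carrier MA" shows "f \<otimes>\<^bsub>MA\<^esub> g \<in> carrier MA"
proof -
  note fg = assms[unfolded MA_carrier]
  have [simp]: "\<And>x. f x \<in> carrier F" "\<And>x. g x \<in> carrier F"
    using fg by auto
  have eq: "(f \<otimes>\<^bsub>MA\<^esub> g) z = (\<Oplus>\<^bsub>F\<^esub>q\<in>supp f \<times> supp g.
      if fst q \<otimes>\<^bsub>M\<^esub> snd q = z then f (fst q) \<otimes>\<^bsub>F\<^esub> g (snd q) else \<zero>\<^bsub>F\<^esub>)" for z
    using fg by (intro MA_mult assms) auto
  have sub: "supp (f \<otimes>\<^bsub>MA\<^esub> g) \<subseteq> (\<lambda>q. fst q \<otimes>\<^bsub>M\<^esub> snd q) ` (supp f \<times> supp g)"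
  proof
    fix z assume "z \<in> supp (f \<otimes>\<^bsub>MA\<^esub> g)"
    then have "(f \<otimes>\<^bsub>MA\<^esub> g) z \<noteq> \<zero>\<^bsub>F\<^esub>" by (simp add: supp_def)
    then have "\<exists>q\<in>supp f \<times> supp g. fst q \<otimes>\<^bsub>M\<^esub> snd q = z"
    proof (rule contrapos_np)
      assume "\<not> (\<exists>q\<in>supp f \<times> supp g. fst q \<otimes>\<^bsub>M\<^esub> snd q = z)"
      then show "(f \<otimes>\<^bsub>MA\<^esub> g) z = \<zero>\<^bsub>F\<^esub>"
        unfolding eq by (intro F.add.finprod_one_eqI if_not_P) blast
    qed
    then show "z \<in> (\<lambda>q. fst q \<otimes>\<^bsub>M\<^esub> snd q) ` (supp f \<times> supp g)" by blast
  qed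
  have "(f \<otimes>\<^bsub>MA\<^esub> g) z \<in> carrier F" for z
    unfolding eq by (rule F.finsum_closed) auto
  moreover have "supp (f \<otimes>\<^bsub>MA\<^esub> g) \<subseteq> carrier M"
    using sub fg by fastforce
  moreover have "finite (supp (f \<otimes>\<^bsub>MA\<^esub> g))"
    using sub fg by (meson finite_SigmaI finite_imageI finite_subset)
  ultimately show ?thesis by (simp add: MA_carrier)
qed

lemma MA_abelian_group: "abelian_group MA"
proof (rule abelian_groupI)
  fix f assume f: "f \<in> carrier MA"
  \<comment> \<open>The additive inverse is the multiple by -1, whose closedness is already
    known.\<close>
  have "(\<ominus>\<^bsub>F\<^esub> \<one>\<^bsub>F\<^esub>) \<odot>\<^bsub>MA\<^esub> f \<in> carrier MA"
    using f by (intro MA_smult_closed) auto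
  moreover have "(\<ominus>\<^bsub>F\<^esub> \<one>\<^bsub>F\<^esub>) \<odot>\<^bsub>MA\<^esub> f \<oplus>\<^bsub>MA\<^esub> f = \<zero>\<^bsub>MA\<^esub>"
    using f by (auto simp: MA_smult MA_add MA_zero F.l_minus F.l_neg)
  ultimately show "\<exists>g\<in>carrier MA. g \<oplus>\<^bsub>MA\<^esub> f = \<zero>\<^bsub>MA\<^esub>" by blast
qed (auto simp: MA_add_closed MA_zero_closed, auto simp: MA_add MA_zero F.a_ac)

sublocale MA: module F MA
proof (rule moduleI)
  show "abelian_group MA" by (rule MA_abelian_group)
qed (auto simp: MA_smult_closed F.cring_axioms,
  auto simp: MA_smult MA_add F.l_distr F.r_distr F.m_assoc)

text \<open>Elements are finite combinations of basis elements. This is the tool that reduces linear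
  and multilinear identities to basis elements, where they become identities in the monoid.\<close>

lemma MA_induct [consumes 1, case_names zero add]:
  assumes f: "f \<in> carrier MA" and zero: "P \<zero>\<^bsub>MA\<^esub>"
    and add: "\<And>c x f. \<lbrakk>c \<in> carrier F; x \<in> carrier M; f \<in> carrier MA; P f\<rbrakk>
        \<Longrightarrow> P (c \<odot>\<^bsub>MA\<^esub> basis_elt F x \<oplus>\<^bsub>MA\<^esub> f)"
  shows "P f"
proof -
  \<comment> \<open>The induction is on a finite set containing the support, so that a point outside
    the support can simply be dropped.\<close>
  have "P f" if "finite S" "f \<in> carrier MA" "supp f \<subseteq> S" for S f
    using that
  proof (induction S arbitrary: f rule: finite_induct)
    case empty
    then have "f = \<zero>\<^bsub>MA\<^esub>" by (auto simp: MA_zero supp_def)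
    then show ?case using zero by simp
  next
    case (insert x S)
    show ?case
    proof (cases "x \<in> supp f")
      case True
      then have x: "x \<in> carrier M" using insert.prems by (auto simp: MA_carrier)
      define g where "g = f(x := \<zero>\<^bsub>F\<^esub>)"
      have sg: "supp g \<subseteq> S" "supp g \<subseteq> supp f"
        using insert.prems by (auto simp: g_def supp_def)
      have g: "g \<in> carrier MA"
        using insert.prems sg finite_subset[OF sg(2)] unfolding MA_carrier by (auto simp: g_def)
      have fx: "f x \<in> carrier F" using insert.prems by simp
      have "f = f x \<odot>\<^bsub>MA\<^esub> basis_elt F x \<oplus>\<^bsub>MA\<^esub> g"
        using insert.prems fx by (auto simp: MA_add MA_smult g_def basis_elt_def)
      then show ?thesis using add[OF fx x g insert.IH[OF g sg(1)]] by simp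
    next
      case False
      then show ?thesis using insert by auto
    qed
  qed
  then show ?thesis using f by (auto simp: MA_carrier)
qed

text \<open>All three products are expanded over the same rectangle, with the union of both supports
  on the left side.\<close>

lemma MA_l_distr:
  assumes f: "f \<in> carrier MA" and g: "g \<in> carrier MA" and h: "h \<in> carrier MA"
  shows "(f \<oplus>\<^bsub>MA\<^esub> g) \<otimes>\<^bsub>MA\<^esub> h = f \<otimes>\<^bsub>MA\<^esub> h \<oplus>\<^bsub>MA\<^esub> g \<otimes>\<^bsub>MA\<^esub> h"
proof
  fix z
  let ?S = "supp f \<union> supp g" and ?T = "supp h"
  have fin: "finite ?S" "finite ?T" using assms by (auto simp: MA_carrier)
  have "supp (f \<oplus>\<^bsub>MA\<^esub> g) \<subseteq> ?S"
    by (auto simp: MA_add supp_def)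
  then have "((f \<oplus>\<^bsub>MA\<^esub> g) \<otimes>\<^bsub>MA\<^esub> h) z = (\<Oplus>\<^bsub>F\<^esub>q\<in>?S \<times> ?T.
      if fst q \<otimes>\<^bsub>M\<^esub> snd q = z then (f \<oplus>\<^bsub>MA\<^esub> g) (fst q) \<otimes>\<^bsub>F\<^esub> h (snd q) else \<zero>\<^bsub>F\<^esub>)"
    using fin assms by (intro MA_mult MA_add_closed) auto
  also have "\<dots> = (\<Oplus>\<^bsub>F\<^esub>q\<in>?S \<times> ?T.
      (if fst q \<otimes>\<^bsub>M\<^esub> snd q = z then f (fst q) \<otimes>\<^bsub>F\<^esub> h (snd q) else \<zero>\<^bsub>F\<^esub>) \<oplus>\<^bsub>F\<^esub>
      (if fst q \<otimes>\<^bsub>M\<^esub> snd q = z then g (fst q) \<otimes>\<^bsub>F\<^esub> h (snd q) else \<zero>\<^bsub>F\<^esub>))"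
    using assms by (intro F.finsum_cong') (auto simp: MA_add F.l_distr)
  also have "\<dots> = (f \<otimes>\<^bsub>MA\<^esub> h) z \<oplus>\<^bsub>F\<^esub> (g \<otimes>\<^bsub>MA\<^esub> h) z"
    using assms fin
    by (subst F.finsum_addf) (auto simp: MA_mult[of f h ?S ?T] MA_mult[of g h ?S ?T])
  finally show "((f \<oplus>\<^bsub>MA\<^esub> g) \<otimes>\<^bsub>MA\<^esub> h) z = (f \<otimes>\<^bsub>MA\<^esub> h \<oplus>\<^bsub>MA\<^esub> g \<otimes>\<^bsub>MA\<^esub> h) z"
    by (simp add: MA_add)
qed

lemma MA_r_distr:
  assumes f: "f \<in> carrier MA" and g: "g \<in> carrier MA" and h: "h \<in> carrier MA"
  shows "h \<otimes>\<^bsub>MA\<^esub> (f \<oplus>\<^bsub>MA\<^esub> g) = h \<otimes>\<^bsub>MA\<^esub> f \<oplus>\<^bsub>MA\<^esub> h \<otimes>\<^bsub>MA\<^esub> g"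
proof
  fix z
  let ?S = "supp h" and ?T = "supp f \<union> supp g"
  have fin: "finite ?S" "finite ?T" using assms by (auto simp: MA_carrier)
  have "supp (f \<oplus>\<^bsub>MA\<^esub> g) \<subseteq> ?T"
    by (auto simp: MA_add supp_def)
  then have "(h \<otimes>\<^bsub>MA\<^esub> (f \<oplus>\<^bsub>MA\<^esub> g)) z = (\<Oplus>\<^bsub>F\<^esub>q\<in>?S \<times> ?T.
      if fst q \<otimes>\<^bsub>M\<^esub> snd q = z then h (fst q) \<otimes>\<^bsub>F\<^esub> (f \<oplus>\<^bsub>MA\<^esub> g) (snd q) else \<zero>\<^bsub>F\<^esub>)"
    using fin assms by (intro MA_mult MA_add_closed) auto
  also have "\<dots> = (\<Oplus>\<^bsub>F\<^esub>q\<in>?S \<times> ?T.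
      (if fst q \<otimes>\<^bsub>M\<^esub> snd q = z then h (fst q) \<otimes>\<^bsub>F\<^esub> f (snd q) else \<zero>\<^bsub>F\<^esub>) \<oplus>\<^bsub>F\<^esub>
      (if fst q \<otimes>\<^bsub>M\<^esub> snd q = z then h (fst q) \<otimes>\<^bsub>F\<^esub> g (snd q) else \<zero>\<^bsub>F\<^esub>))"
    using assms by (intro F.finsum_cong') (auto simp: MA_add F.r_distr)
  also have "\<dots> = (h \<otimes>\<^bsub>MA\<^esub> f) z \<oplus>\<^bsub>F\<^esub> (h \<otimes>\<^bsub>MA\<^esub> g) z"
    using assms fin
    by (subst F.finsum_addf) (auto simp: MA_mult[of h f ?S ?T] MA_mult[of h g ?S ?T])
  finally show "(h \<otimes>\<^bsub>MA\<^esub> (f \<oplus>\<^bsub>MA\<^esub> g)) z = (h \<otimes>\<^bsub>MA\<^esub> f \<oplus>\<^bsub>MA\<^esub> h \<otimes>\<^bsub>MA\<^esub> g) z"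
    by (simp add: MA_add)
qed

lemma MA_smult_l:
  assumes c: "c \<in> carrier F" and f: "f \<in> carrier MA" and g: "g \<in> carrier MA"
  shows "(c \<odot>\<^bsub>MA\<^esub> f) \<otimes>\<^bsub>MA\<^esub> g = c \<odot>\<^bsub>MA\<^esub> (f \<otimes>\<^bsub>MA\<^esub> g)"
proof
  fix z
  have fin: "finite (supp f)" "finite (supp g)" using assms by (auto simp: MA_carrier)
  have "supp (c \<odot>\<^bsub>MA\<^esub> f) \<subseteq> supp f" using c by (auto simp: MA_smult supp_def)
  then have "((c \<odot>\<^bsub>MA\<^esub> f) \<otimes>\<^bsub>MA\<^esub> g) z = (\<Oplus>\<^bsub>F\<^esub>q\<in>supp f \<times> supp g.
      if fst q \<otimes>\<^bsub>M\<^esub> snd q = z then (c \<odot>\<^bsub>MA\<^esub> f) (fst q) \<otimes>\<^bsub>F\<^esub> g (snd q) else \<zero>\<^bsub>F\<^esub>)"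
    using fin assms by (intro MA_mult MA_smult_closed) auto
  also have "\<dots> = (\<Oplus>\<^bsub>F\<^esub>q\<in>supp f \<times> supp g. c \<otimes>\<^bsub>F\<^esub>
      (if fst q \<otimes>\<^bsub>M\<^esub> snd q = z then f (fst q) \<otimes>\<^bsub>F\<^esub> g (snd q) else \<zero>\<^bsub>F\<^esub>))"
    using assms by (intro F.finsum_cong') (auto simp: MA_smult F.m_assoc)
  also have "\<dots> = c \<otimes>\<^bsub>F\<^esub> (f \<otimes>\<^bsub>MA\<^esub> g) z"
    using assms fin
    by (subst F.finsum_rdistr[symmetric]) (auto simp: MA_mult[of f g "supp f" "supp g"])
  finally show "((c \<odot>\<^bsub>MA\<^esub> f) \<otimes>\<^bsub>MA\<^esub> g) z = (c \<odot>\<^bsub>MA\<^esub> (f \<otimes>\<^bsub>MA\<^esub> g)) z"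
    by (simp add: MA_smult)
qed

lemma MA_smult_r:
  assumes c: "c \<in> carrier F" and f: "f \<in> carrier MA" and g: "g \<in> carrier MA"
  shows "f \<otimes>\<^bsub>MA\<^esub> (c \<odot>\<^bsub>MA\<^esub> g) = c \<odot>\<^bsub>MA\<^esub> (f \<otimes>\<^bsub>MA\<^esub> g)"
proof
  fix z
  have fin: "finite (supp f)" "finite (supp g)" using assms by (auto simp: MA_carrier)
  have "supp (c \<odot>\<^bsub>MA\<^esub> g) \<subseteq> supp g" using c by (auto simp: MA_smult supp_def)
  then have "(f \<otimes>\<^bsub>MA\<^esub> (c \<odot>\<^bsub>MA\<^esub> g)) z = (\<Oplus>\<^bsub>F\<^esub>q\<in>supp f \<times> supp g.
      if fst q \<otimes>\<^bsub>M\<^esub> snd q = z then f (fst q) \<otimes>\<^bsub>F\<^esub> (c \<odot>\<^bsub>MA\<^esub> g) (snd q) else \<zero>\<^bsub>F\<^esub>)"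
    using fin assms by (intro MA_mult MA_smult_closed) auto
  also have "\<dots> = (\<Oplus>\<^bsub>F\<^esub>q\<in>supp f \<times> supp g. c \<otimes>\<^bsub>F\<^esub>
      (if fst q \<otimes>\<^bsub>M\<^esub> snd q = z then f (fst q) \<otimes>\<^bsub>F\<^esub> g (snd q) else \<zero>\<^bsub>F\<^esub>))"
    using assms by (intro F.finsum_cong') (auto simp: MA_smult F.m_lcomm)
  also have "\<dots> = c \<otimes>\<^bsub>F\<^esub> (f \<otimes>\<^bsub>MA\<^esub> g) z"
    using assms fin
    by (subst F.finsum_rdistr[symmetric]) (auto simp: MA_mult[of f g "supp f" "supp g"])
  finally show "(f \<otimes>\<^bsub>MA\<^esub> (c \<odot>\<^bsub>MA\<^esub> g)) z = (c \<odot>\<^bsub>MA\<^esub> (f \<otimes>\<^bsub>MA\<^esub> g)) z"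
    by (simp add: MA_smult)
qed

lemma MA_basis_mult:
  assumes "x \<in> carrier M" "y \<in> carrier M"
  shows "basis_elt F x \<otimes>\<^bsub>MA\<^esub> basis_elt F y = basis_elt F (x \<otimes>\<^bsub>M\<^esub> y)"
proof
  fix z
  have "(basis_elt F x \<otimes>\<^bsub>MA\<^esub> basis_elt F y) z = (\<Oplus>\<^bsub>F\<^esub>q\<in>{x} \<times> {y}.
    if fst q \<otimes>\<^bsub>M\<^esub> snd q = z then basis_elt F x (fst q) \<otimes>\<^bsub>F\<^esub> basis_elt F y (snd q) else \<zero>\<^bsub>F\<^esub>)"
    using assms by (intro MA_mult MA_basis_closed) (auto simp: supp_def basis_elt_def)
  then show "(basis_elt F x \<otimes>\<^bsub>MA\<^esub> basis_elt F y) z = basis_elt F (x \<otimes>\<^bsub>M\<^esub> y) z"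
    by (simp add: basis_elt_def)
qed

text \<open>Zero is its own multiple by the scalar zero, and that scalar can be pulled out of the
  product.\<close>

lemma MA_zero_mult:
  assumes "f \<in> carrier MA"
  shows "\<zero>\<^bsub>MA\<^esub> \<otimes>\<^bsub>MA\<^esub> f = \<zero>\<^bsub>MA\<^esub>" "f \<otimes>\<^bsub>MA\<^esub> \<zero>\<^bsub>MA\<^esub> = \<zero>\<^bsub>MA\<^esub>"
proof -
  have "(\<zero>\<^bsub>F\<^esub> \<odot>\<^bsub>MA\<^esub> \<zero>\<^bsub>MA\<^esub>) \<otimes>\<^bsub>MA\<^esub> f = \<zero>\<^bsub>F\<^esub> \<odot>\<^bsub>MA\<^esub> (\<zero>\<^bsub>MA\<^esub> \<otimes>\<^bsub>MA\<^esub> f)"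
    "f \<otimes>\<^bsub>MA\<^esub> (\<zero>\<^bsub>F\<^esub> \<odot>\<^bsub>MA\<^esub> \<zero>\<^bsub>MA\<^esub>) = \<zero>\<^bsub>F\<^esub> \<odot>\<^bsub>MA\<^esub> (f \<otimes>\<^bsub>MA\<^esub> \<zero>\<^bsub>MA\<^esub>)"
    by (rule MA_smult_l MA_smult_r; simp add: assms MA_zero_closed)+
  then show "\<zero>\<^bsub>MA\<^esub> \<otimes>\<^bsub>MA\<^esub> f = \<zero>\<^bsub>MA\<^esub>" "f \<otimes>\<^bsub>MA\<^esub> \<zero>\<^bsub>MA\<^esub> = \<zero>\<^bsub>MA\<^esub>"
    using assms by (simp_all add: MA_mult_closed MA_zero_closed)
qed

lemmas MA_bilinear = MA_l_distr MA_r_distr MA_smult_l MA_smult_r MA_zero_mult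

text \<open>Both sides are linear in each factor. Three inductions replace \<open>h\<close>,
  \<open>g\<close> and \<open>f\<close> in turn by basis elements, which leaves associativity in
  \<open>M\<close>.\<close>

lemma MA_assoc:
  assumes f: "f \<in> carrier MA" and g: "g \<in> carrier MA" and h: "h \<in> carrier MA"
  shows "f \<otimes>\<^bsub>MA\<^esub> g \<otimes>\<^bsub>MA\<^esub> h = f \<otimes>\<^bsub>MA\<^esub> (g \<otimes>\<^bsub>MA\<^esub> h)"
proof -
  have 1: "basis_elt F x \<otimes>\<^bsub>MA\<^esub> basis_elt F y \<otimes>\<^bsub>MA\<^esub> h = basis_elt F x \<otimes>\<^bsub>MA\<^esub> (basis_elt F y \<otimes>\<^bsub>MA\<^esub> h)"
    if "x \<in> carrier M" "y \<in> carrier M" for x y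
    using h by (induction h rule: MA_induct)
      (use that in \<open>simp_all add: MA_bilinear MA_mult_closed MA_basis_mult M.m_assoc\<close>)
  have 2: "basis_elt F x \<otimes>\<^bsub>MA\<^esub> g \<otimes>\<^bsub>MA\<^esub> h = basis_elt F x \<otimes>\<^bsub>MA\<^esub> (g \<otimes>\<^bsub>MA\<^esub> h)"
    if "x \<in> carrier M" for x
    using g by (induction g rule: MA_induct)
      (use that h 1 in \<open>simp_all add: MA_bilinear MA_mult_closed\<close>)
  show ?thesis
    using f by (induction f rule: MA_induct)
      (use g h 2 in \<open>simp_all add: MA_bilinear MA_mult_closed\<close>)
qed

lemma MA_one_mult:
  assumes "f \<in> carrier MA"
  shows "\<one>\<^bsub>MA\<^esub> \<otimes>\<^bsub>MA\<^esub> f = f" "f \<otimes>\<^bsub>MA\<^esub> \<one>\<^bsub>MA\<^esub> = f"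
  using assms
  by (induction f rule: MA_induct; simp add: MA_one MA_bilinear MA_basis_mult)+

lemma MA_assoc_algebra: "assoc_algebra F MA"
proof -
  have "\<one>\<^bsub>MA\<^esub> \<in> carrier MA" by (simp add: MA_one)
  then have "ring MA"
    by (intro ringI monoidI)
      (simp_all add: MA_abelian_group MA_mult_closed MA_assoc MA_one_mult MA_l_distr MA_r_distr)
  then show ?thesis
    by (intro assoc_algebra.intro assoc_algebra_axioms.intro MA_smult_l MA_smult_r MA.module_axioms)
qed

end

section \<open>Homomorphisms and quotients of algebras\<close>

text \<open>Universal properties produce homomorphisms with no information on bijectivity; an
  \<open>alg_iso\<close> is then assembled from two of them.\<close>

definition alg_hom ::
  "('f, 'm) ring_scheme \<Rightarrow> ('f, 'a, 'k) module_scheme \<Rightarrow> ('f, 'b, 'l) module_scheme \<Rightarrow>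
   ('a \<Rightarrow> 'b) set" where
  "alg_hom F A B = {h \<in> ring_hom A B. \<forall>c \<in> carrier F. \<forall>x \<in> carrier A.
     h (c \<odot>\<^bsub>A\<^esub> x) = c \<odot>\<^bsub>B\<^esub> h x}"

lemma alg_homI:
  assumes "\<And>x. x \<in> carrier A \<Longrightarrow> h x \<in> carrier B"
    and "\<And>x y. x \<in> carrier A \<Longrightarrow> y \<in> carrier A \<Longrightarrow> h (x \<oplus>\<^bsub>A\<^esub> y) = h x \<oplus>\<^bsub>B\<^esub> h y"
    and "\<And>x y. x \<in> carrier A \<Longrightarrow> y \<in> carrier A \<Longrightarrow> h (x \<otimes>\<^bsub>A\<^esub> y) = h x \<otimes>\<^bsub>B\<^esub> h y"
    and "h \<one>\<^bsub>A\<^esub> = \<one>\<^bsub>B\<^esub>"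
    and "\<And>c x. c \<in> carrier F \<Longrightarrow> x \<in> carrier A \<Longrightarrow> h (c \<odot>\<^bsub>A\<^esub> x) = c \<odot>\<^bsub>B\<^esub> h x"
  shows "h \<in> alg_hom F A B"
  using assms by (simp add: alg_hom_def ring_hom_memI)

lemma alg_homD:
  assumes "h \<in> alg_hom F A B"
  shows "x \<in> carrier A \<Longrightarrow> h x \<in> carrier B"
    and "x \<in> carrier A \<Longrightarrow> y \<in> carrier A \<Longrightarrow> h (x \<oplus>\<^bsub>A\<^esub> y) = h x \<oplus>\<^bsub>B\<^esub> h y"
    and "x \<in> carrier A \<Longrightarrow> y \<in> carrier A \<Longrightarrow> h (x \<otimes>\<^bsub>A\<^esub> y) = h x \<otimes>\<^bsub>B\<^esub> h y"
    and "h \<one>\<^bsub>A\<^esub> = \<one>\<^bsub>B\<^esub>"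
    and "c \<in> carrier F \<Longrightarrow> x \<in> carrier A \<Longrightarrow> h (c \<odot>\<^bsub>A\<^esub> x) = c \<odot>\<^bsub>B\<^esub> h x"
  using assms by (auto simp: alg_hom_def ring_hom_def)

lemma alg_hom_id: "(\<lambda>x. x) \<in> alg_hom F A A"
  by (rule alg_homI) auto

lemma alg_hom_comp:
  "h \<in> alg_hom F A B \<Longrightarrow> g \<in> alg_hom F B C \<Longrightarrow> (\<lambda>x. g (h x)) \<in> alg_hom F A C"
  by (rule alg_homI) (simp_all add: alg_homD)

lemma alg_isoI:
  assumes "h \<in> alg_hom F A B" "g \<in> alg_hom F B A"
    and "\<And>x. x \<in> carrier A \<Longrightarrow> g (h x) = x" "\<And>y. y \<in> carrier B \<Longrightarrow> h (g y) = y"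
  shows "alg_iso F A B"
proof -
  have "bij_betw h (carrier A) (carrier B)"
    using assms by (intro bij_betwI[where g = g]) (auto simp: alg_homD)
  then show ?thesis
    using assms(1) by (auto simp: alg_iso_def ring_iso_def alg_hom_def)
qed

text \<open>The inverse of a bijective homomorphism respects the operations because \<open>h\<close>
  is injective: both sides of each law have the same image under \<open>h\<close>. The operations of
  \<open>A\<close> must stay in its carrier for this, hence the hypothesis on
  \<open>A\<close>.\<close>

lemma alg_isoE:
  assumes "alg_iso F A B" "assoc_algebra F A"
  obtains h g where "h \<in> alg_hom F A B" "g \<in> alg_hom F B A"
    "\<And>x. x \<in> carrier A \<Longrightarrow> g (h x) = x" "\<And>y. y \<in> carrier B \<Longrightarrow> h (g y) = y"
proof -
  interpret A: assoc_algebra F A by fact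
  obtain h where h: "h \<in> alg_hom F A B" and bij: "bij_betw h (carrier A) (carrier B)"
    using assms(1) by (auto simp: alg_iso_def ring_iso_def alg_hom_def)
  define g where "g = inv_into (carrier A) h"
  have gh: "g (h x) = x" if "x \<in> carrier A" for x
    using bij that by (simp add: g_def bij_betw_def)
  have hg: "h (g y) = y" and g: "g y \<in> carrier A" if "y \<in> carrier B" for y
    using bij that by (auto simp: g_def bij_betw_def f_inv_into_f inv_into_into)
  have "g \<in> alg_hom F B A"
  proof (rule alg_homI)
    show "g (x \<oplus>\<^bsub>B\<^esub> y) = g x \<oplus>\<^bsub>A\<^esub> g y" if "x \<in> carrier B" "y \<in> carrier B" for x y
      using gh[of "g x \<oplus>\<^bsub>A\<^esub> g y"] that by (simp add: alg_homD[OF h] g hg)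
    show "g (x \<otimes>\<^bsub>B\<^esub> y) = g x \<otimes>\<^bsub>A\<^esub> g y" if "x \<in> carrier B" "y \<in> carrier B" for x y
      using gh[of "g x \<otimes>\<^bsub>A\<^esub> g y"] that by (simp add: alg_homD[OF h] g hg)
    show "g (c \<odot>\<^bsub>B\<^esub> x) = c \<odot>\<^bsub>A\<^esub> g x" if "c \<in> carrier F" "x \<in> carrier B" for c x
      using gh[of "c \<odot>\<^bsub>A\<^esub> g x"] that by (simp add: alg_homD[OF h] g hg)
    show "g \<one>\<^bsub>B\<^esub> = \<one>\<^bsub>A\<^esub>"
      using gh[of "\<one>\<^bsub>A\<^esub>"] by (simp add: alg_homD[OF h])
  qed (rule g)
  with h gh hg that show ?thesis by blast
qed

lemma alg_iso_refl: "alg_iso F A A"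
  by (rule alg_isoI[OF alg_hom_id alg_hom_id]) auto

lemma alg_iso_trans:
  assumes "alg_iso F A B" "alg_iso F B C"
  shows "alg_iso F A C"
proof -
  from assms obtain g h where g: "g \<in> ring_iso A B" and h: "h \<in> ring_iso B C"
    and sm: "\<forall>c\<in>carrier F. \<forall>x\<in>carrier A. g (c \<odot>\<^bsub>A\<^esub> x) = c \<odot>\<^bsub>B\<^esub> g x"
      "\<forall>c\<in>carrier F. \<forall>x\<in>carrier B. h (c \<odot>\<^bsub>B\<^esub> x) = c \<odot>\<^bsub>C\<^esub> h x"
    by (auto simp: alg_iso_def)
  have "h \<circ> g \<in> ring_iso A C" using g h by (rule ring_iso_set_trans)
  then show ?thesis
    using sm g unfolding alg_iso_def
    by (intro bexI[of _ "h \<circ> g"]) (auto simp: ring_iso_memE)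
qed

lemma alg_iso_sym: "alg_iso F A B \<Longrightarrow> assoc_algebra F A \<Longrightarrow> alg_iso F B A"
  by (erule alg_isoE) (auto intro: alg_isoI)

section \<open>Quotients of algebras and maps out of them\<close>

context assoc_algebra
begin

text \<open>A scalar acts as multiplication by the ring element \<open>c 1\<close>, and ideals
  absorb products.\<close>

lemma smult_in_ideal: "ideal J A \<Longrightarrow> c \<in> carrier F \<Longrightarrow> y \<in> J \<Longrightarrow> c \<odot>\<^bsub>A\<^esub> y \<in> J"
proof -
  assume J: "ideal J A" and c: "c \<in> carrier F" and y: "y \<in> J"
  interpret J: ideal J A by fact
  have "(c \<odot>\<^bsub>A\<^esub> \<one>\<^bsub>A\<^esub>) \<otimes>\<^bsub>A\<^esub> y \<in> J" using c y by (intro J.I_l_closed) auto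
  moreover have "(c \<odot>\<^bsub>A\<^esub> \<one>\<^bsub>A\<^esub>) \<otimes>\<^bsub>A\<^esub> y = c \<odot>\<^bsub>A\<^esub> y"
    using c J.Icarr[OF y] by (simp add: smult_mult_left)
  ultimately show ?thesis by simp
qed

lemma quot_simps:
  assumes J: "ideal J A" and x: "x \<in> carrier A"
  shows "y \<in> carrier A \<Longrightarrow>
      (J +>\<^bsub>A\<^esub> x) \<otimes>\<^bsub>alg_quot A J\<^esub> (J +>\<^bsub>A\<^esub> y) = J +>\<^bsub>A\<^esub> (x \<otimes>\<^bsub>A\<^esub> y)"
    and "y \<in> carrier A \<Longrightarrow>
      (J +>\<^bsub>A\<^esub> x) \<oplus>\<^bsub>alg_quot A J\<^esub> (J +>\<^bsub>A\<^esub> y) = J +>\<^bsub>A\<^esub> (x \<oplus>\<^bsub>A\<^esub> y)"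
    and "c \<in> carrier F \<Longrightarrow> c \<odot>\<^bsub>alg_quot A J\<^esub> (J +>\<^bsub>A\<^esub> x) = J +>\<^bsub>A\<^esub> (c \<odot>\<^bsub>A\<^esub> x)"
proof -
  interpret J: ideal J A by fact
  show "(J +>\<^bsub>A\<^esub> x) \<otimes>\<^bsub>alg_quot A J\<^esub> (J +>\<^bsub>A\<^esub> y) = J +>\<^bsub>A\<^esub> (x \<otimes>\<^bsub>A\<^esub> y)" if "y \<in> carrier A"
    using x that by (simp add: alg_quot_def FactRing_def J.rcoset_mult_add)
  show "(J +>\<^bsub>A\<^esub> x) \<oplus>\<^bsub>alg_quot A J\<^esub> (J +>\<^bsub>A\<^esub> y) = J +>\<^bsub>A\<^esub> (x \<oplus>\<^bsub>A\<^esub> y)" if "y \<in> carrier A"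
    using x that by (simp add: alg_quot_def FactRing_def J.a_rcos_sum)
  show "c \<odot>\<^bsub>alg_quot A J\<^esub> (J +>\<^bsub>A\<^esub> x) = J +>\<^bsub>A\<^esub> (c \<odot>\<^bsub>A\<^esub> x)" if c: "c \<in> carrier F"
  proof -
    \<comment> \<open>All cosets in the union that defines the scalar multiple are equal:
      representatives differ by an element of \<open>J\<close>, and so do their multiples.\<close>
    have "J +>\<^bsub>A\<^esub> (c \<odot>\<^bsub>A\<^esub> y) = J +>\<^bsub>A\<^esub> (c \<odot>\<^bsub>A\<^esub> x)" if y: "y \<in> J +>\<^bsub>A\<^esub> x" for y
    proof -
      obtain j where j: "j \<in> J" "y = j \<oplus>\<^bsub>A\<^esub> x"
        using y by (auto simp: a_r_coset_def')
      have "c \<odot>\<^bsub>A\<^esub> y = c \<odot>\<^bsub>A\<^esub> j \<oplus>\<^bsub>A\<^esub> c \<odot>\<^bsub>A\<^esub> x"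
        using j x c by (simp add: smult_r_distr J.Icarr)
      then have "c \<odot>\<^bsub>A\<^esub> y \<in> J +>\<^bsub>A\<^esub> (c \<odot>\<^bsub>A\<^esub> x)"
        using smult_in_ideal[OF J c j(1)] by (auto simp: a_r_coset_def')
      then show ?thesis
        using c x by (intro J.a_repr_independence'[symmetric]) auto
    qed
    moreover have "x \<in> J +>\<^bsub>A\<^esub> x" using x by (rule J.a_rcos_self)
    ultimately have "(\<Union>y\<in>J +>\<^bsub>A\<^esub> x. J +>\<^bsub>A\<^esub> (c \<odot>\<^bsub>A\<^esub> y)) = J +>\<^bsub>A\<^esub> (c \<odot>\<^bsub>A\<^esub> x)" by blast
    then show ?thesis by (simp add: alg_quot_def)
  qed
qed

lemma quot_carrier: "carrier (alg_quot A J) = (\<lambda>x. J +>\<^bsub>A\<^esub> x) ` carrier A"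
  by (auto simp: alg_quot_def FactRing_def A_RCOSETS_def')

lemma quot_one: "\<one>\<^bsub>alg_quot A J\<^esub> = J +>\<^bsub>A\<^esub> \<one>\<^bsub>A\<^esub>"
  by (simp add: alg_quot_def FactRing_def)

text \<open>\<open>alg_quot A J\<close> is another record than \<open>A Quot J\<close> with the same
  ring fields, so the axioms are carried over one by one.\<close>

lemma quot_ring: "ideal J A \<Longrightarrow> ring (alg_quot A J)"
proof -
  assume "ideal J A"
  then interpret Q: ring "A Quot J" by (rule ideal.quotient_is_ring)
  have [simp]: "carrier (alg_quot A J) = carrier (A Quot J)"
    "(\<otimes>\<^bsub>alg_quot A J\<^esub>) = (\<otimes>\<^bsub>A Quot J\<^esub>)" "(\<oplus>\<^bsub>alg_quot A J\<^esub>) = (\<oplus>\<^bsub>A Quot J\<^esub>)"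
    "\<one>\<^bsub>alg_quot A J\<^esub> = \<one>\<^bsub>A Quot J\<^esub>" "\<zero>\<^bsub>alg_quot A J\<^esub> = \<zero>\<^bsub>A Quot J\<^esub>"
    by (simp_all add: alg_quot_def)
  show ?thesis
  proof (intro ringI abelian_groupI monoidI)
    show "x \<oplus>\<^bsub>alg_quot A J\<^esub> y = y \<oplus>\<^bsub>alg_quot A J\<^esub> x"
      if "x \<in> carrier (alg_quot A J)" "y \<in> carrier (alg_quot A J)" for x y
      using that by (simp add: Q.a_comm)
  qed (auto simp: Q.a_assoc Q.m_assoc Q.l_distr Q.r_distr Q.l_neg
      intro: bexI[of _ "\<ominus>\<^bsub>A Quot J\<^esub> _"])
qed

lemma quot_algebra:
  assumes J: "ideal J A" shows "assoc_algebra F (alg_quot A J)"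
proof -
  interpret Q: ring "alg_quot A J" using J by (rule quot_ring)
  show ?thesis
  proof (intro assoc_algebra.intro assoc_algebra_axioms.intro moduleI)
    show "cring F" "abelian_group (alg_quot A J)" "ring (alg_quot A J)"
      by unfold_locales
  qed (auto simp: quot_carrier quot_simps[OF J] smult_mult_left smult_mult_right
      smult_l_distr smult_r_distr smult_assoc1)
qed

lemma quot_hom:
  assumes "ideal J A" shows "(\<lambda>x. J +>\<^bsub>A\<^esub> x) \<in> alg_hom F A (alg_quot A J)"
  using assms by (intro alg_homI) (auto simp: quot_simps quot_one quot_carrier)

lemma alg_hom_ring_hom:
  assumes "assoc_algebra F B" "h \<in> alg_hom F A B" shows "ring_hom_ring A B h"
proof -
  interpret B: assoc_algebra F B by fact
  show ?thesis using assms(2)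
    by (intro ring_hom_ringI2 ring_axioms B.ring_axioms) (simp add: alg_hom_def)
qed

text \<open>The kernel of \<open>h\<close> is an ideal; containing the generators \<open>S\<close>,
  it contains the ideal they generate, so \<open>h\<close> is constant on cosets.\<close>

lemma quot_lift:
  assumes B: "assoc_algebra F B" and h: "h \<in> alg_hom F A B"
    and S: "S \<subseteq> carrier A" "\<And>s. s \<in> S \<Longrightarrow> h s = \<zero>\<^bsub>B\<^esub>"
  obtains g where "g \<in> alg_hom F (alg_quot A (Idl\<^bsub>A\<^esub> S)) B"
    "\<And>x. x \<in> carrier A \<Longrightarrow> g ((Idl\<^bsub>A\<^esub> S) +>\<^bsub>A\<^esub> x) = h x"
proof -
  interpret B: assoc_algebra F B by fact
  interpret h: ring_hom_ring A B h using B h by (rule alg_hom_ring_hom)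
  define J where "J = Idl\<^bsub>A\<^esub> S"
  have J: "ideal J A" unfolding J_def using S(1) by (rule genideal_ideal)
  interpret J: ideal J A by fact
  have "J \<subseteq> a_kernel A B h"
    unfolding J_def a_kernel_def' using S h.kernel_is_ideal[unfolded a_kernel_def']
    by (intro genideal_minimal subsetI CollectI conjI) blast+
  then have ker: "h j = \<zero>\<^bsub>B\<^esub>" if "j \<in> J" for j
    using that unfolding a_kernel_def' by blast
  \<comment> \<open>The image of a coset under \<open>h\<close> is a singleton, so the description
    picks its only element.\<close>
  define g where "g Y = (THE b. b \<in> h ` Y)" for Y
  have g: "g (J +>\<^bsub>A\<^esub> x) = h x" if x: "x \<in> carrier A" for x
  proof -
    have "h y = h x" if "y \<in> J +>\<^bsub>A\<^esub> x" for y
      using that x ker by (auto simp: a_r_coset_def' J.Icarr)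
    moreover have "x \<in> J +>\<^bsub>A\<^esub> x" using x by (rule J.a_rcos_self)
    ultimately have "h ` (J +>\<^bsub>A\<^esub> x) = {h x}" by blast
    then show ?thesis by (simp add: g_def)
  qed
  have "g \<in> alg_hom F (alg_quot A J) B"
    by (rule alg_homI) (auto simp: quot_carrier quot_one quot_simps[OF J] g alg_homD[OF h])
  then show ?thesis using g that by (simp add: J_def)
qed

end

section \<open>Universal properties\<close>

lemma alg_hom_minus:
  assumes "assoc_algebra F A" "assoc_algebra F B" "h \<in> alg_hom F A B"
    and x: "x \<in> carrier A" "y \<in> carrier A"
  shows "h (x \<ominus>\<^bsub>A\<^esub> y) = h x \<ominus>\<^bsub>B\<^esub> h y"
proof -
  interpret h: ring_hom_ring A B h
    using assms(1-3) by (rule assoc_algebra.alg_hom_ring_hom)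
  show ?thesis using x by (simp add: a_minus_def)
qed

lemma alg_hom_pow:
  fixes n :: nat
  assumes "assoc_algebra F A" "assoc_algebra F B" "h \<in> alg_hom F A B" and x: "x \<in> carrier A"
  shows "h (x [^]\<^bsub>A\<^esub> n) = h x [^]\<^bsub>B\<^esub> n"
proof -
  interpret h: ring_hom_ring A B h
    using assms(1-3) by (rule assoc_algebra.alg_hom_ring_hom)
  show ?thesis using x by (induction n) simp_all
qed

lemma alg_hom_zero:
  assumes "assoc_algebra F A" "assoc_algebra F B" "h \<in> alg_hom F A B"
  shows "h \<zero>\<^bsub>A\<^esub> = \<zero>\<^bsub>B\<^esub>"
proof -
  interpret h: ring_hom_ring A B h
    using assms(1-3) by (rule assoc_algebra.alg_hom_ring_hom)
  show ?thesis by simp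
qed

section \<open>The universal property of the monoid algebra\<close>

context cring_monoid
begin

lemma MA_hom_eq:
  assumes B: "assoc_algebra F B" and h: "h \<in> alg_hom F MA B" and g: "g \<in> alg_hom F MA B"
    and eq: "\<And>x. x \<in> carrier M \<Longrightarrow> h (basis_elt F x) = g (basis_elt F x)"
    and f: "f \<in> carrier MA"
  shows "h f = g f"
  using f
proof (induction f rule: MA_induct)
  case zero
  then show ?case
    by (simp add: alg_hom_zero[OF MA_assoc_algebra B h] alg_hom_zero[OF MA_assoc_algebra B g])
next
  case (add c x f)
  then show ?case by (simp add: alg_homD[OF h] alg_homD[OF g] eq)
qed

text \<open>The linear extension of a multiplicative map \<open>M\<close> to \<open>B\<close> is an
  algebra homomorphism. Together with the uniqueness in \<open>MA_hom_eq\<close> this serves twice: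
  for words (free algebras) and for products of carriers (tensor products).\<close>

lemma MA_lift:
  assumes B: "assoc_algebra F B"
    and u: "\<And>x. x \<in> carrier M \<Longrightarrow> u x \<in> carrier B"
    and u_mult: "\<And>x y. x \<in> carrier M \<Longrightarrow> y \<in> carrier M \<Longrightarrow> u (x \<otimes>\<^bsub>M\<^esub> y) = u x \<otimes>\<^bsub>B\<^esub> u y"
    and u_one: "u \<one>\<^bsub>M\<^esub> = \<one>\<^bsub>B\<^esub>"
  obtains h where "h \<in> alg_hom F MA B" "\<And>x. x \<in> carrier M \<Longrightarrow> h (basis_elt F x) = u x"
proof -
  interpret B: assoc_algebra F B by fact
  define h where "h f = (\<Oplus>\<^bsub>B\<^esub>x\<in>supp f. f x \<odot>\<^bsub>B\<^esub> u x)" for f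
  \<comment> \<open>Enlarging the index set only adds zero terms; it must stay inside
    \<open>carrier M\<close>, where \<open>u\<close> has values in \<open>B\<close>.\<close>
  have h_eq: "h f = (\<Oplus>\<^bsub>B\<^esub>x\<in>S. f x \<odot>\<^bsub>B\<^esub> u x)"
    if "f \<in> carrier MA" "finite S" "supp f \<subseteq> S" "S \<subseteq> carrier M" for f S
    unfolding h_def
  proof (rule B.add.finprod_mono_neutral_cong_left)
    show "f x \<odot>\<^bsub>B\<^esub> u x = \<zero>\<^bsub>B\<^esub>" if "x \<in> S - supp f" for x
    proof -
      have "f x = \<zero>\<^bsub>F\<^esub>" using that by (simp add: supp_def)
      then show ?thesis using that \<open>S \<subseteq> carrier M\<close> u by auto
    qed
  qed (use that u in auto)
  have h_closed: "h f \<in> carrier B" if "f \<in> carrier MA" for f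
    unfolding h_def using that u by (intro B.finsum_closed) (auto simp: MA_carrier)
  have h_add: "h (f \<oplus>\<^bsub>MA\<^esub> g) = h f \<oplus>\<^bsub>B\<^esub> h g"
    if f: "f \<in> carrier MA" and g: "g \<in> carrier MA" for f g
  proof -
    let ?S = "supp f \<union> supp g"
    have S: "finite ?S" "?S \<subseteq> carrier M" using f g by (auto simp: MA_carrier)
    have "supp (f \<oplus>\<^bsub>MA\<^esub> g) \<subseteq> ?S" by (auto simp: MA_add supp_def)
    then have "h (f \<oplus>\<^bsub>MA\<^esub> g) = (\<Oplus>\<^bsub>B\<^esub>x\<in>?S. (f \<oplus>\<^bsub>MA\<^esub> g) x \<odot>\<^bsub>B\<^esub> u x)"
      using S f g by (intro h_eq) auto
    also have "\<dots> = (\<Oplus>\<^bsub>B\<^esub>x\<in>?S. f x \<odot>\<^bsub>B\<^esub> u x \<oplus>\<^bsub>B\<^esub> g x \<odot>\<^bsub>B\<^esub> u x)"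
      using S u f g MA_closed[OF f] MA_closed[OF g]
      by (intro B.finsum_cong') (auto simp: MA_add intro!: B.smult_l_distr)
    also have "\<dots> = h f \<oplus>\<^bsub>B\<^esub> h g"
      using S u f g MA_closed[OF f] MA_closed[OF g]
      by (subst B.finsum_addf) (auto simp: h_eq[of f ?S] h_eq[of g ?S])
    finally show ?thesis .
  qed
  have h_basis: "h (c \<odot>\<^bsub>MA\<^esub> basis_elt F x) = c \<odot>\<^bsub>B\<^esub> u x"
    if c: "c \<in> carrier F" and x: "x \<in> carrier M" for c x
  proof -
    have "supp (c \<odot>\<^bsub>MA\<^esub> basis_elt F x) \<subseteq> {x}"
      using c by (auto simp: supp_def MA_smult basis_elt_def)
    then have "h (c \<odot>\<^bsub>MA\<^esub> basis_elt F x) =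
        (\<Oplus>\<^bsub>B\<^esub>y\<in>{x}. (c \<odot>\<^bsub>MA\<^esub> basis_elt F x) y \<odot>\<^bsub>B\<^esub> u y)"
      using c x by (intro h_eq) auto
    also have "\<dots> = c \<odot>\<^bsub>B\<^esub> u x"
      using c x u by (simp add: MA_smult basis_elt_def)
    finally show ?thesis .
  qed
  have h_zero: "h \<zero>\<^bsub>MA\<^esub> = \<zero>\<^bsub>B\<^esub>"
    by (simp add: h_def MA_zero supp_def)
  have h_smult: "h (c \<odot>\<^bsub>MA\<^esub> f) = c \<odot>\<^bsub>B\<^esub> h f"
    if c: "c \<in> carrier F" and f: "f \<in> carrier MA" for c f
    using f
  proof (induction f rule: MA_induct)
    case (add d x f)
    have "h (c \<odot>\<^bsub>MA\<^esub> (d \<odot>\<^bsub>MA\<^esub> basis_elt F x \<oplus>\<^bsub>MA\<^esub> f)) =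
        h ((c \<otimes>\<^bsub>F\<^esub> d) \<odot>\<^bsub>MA\<^esub> basis_elt F x \<oplus>\<^bsub>MA\<^esub> c \<odot>\<^bsub>MA\<^esub> f)"
      using add c by (simp add: MA.smult_r_distr MA.smult_assoc1)
    also have "\<dots> = c \<odot>\<^bsub>B\<^esub> h (d \<odot>\<^bsub>MA\<^esub> basis_elt F x \<oplus>\<^bsub>MA\<^esub> f)"
      using add c u by (simp add: h_add h_basis h_closed B.smult_r_distr B.smult_assoc1)
    finally show ?case .
  qed (use c in \<open>simp add: h_zero\<close>)
  have h_u: "h (basis_elt F x) = u x" if "x \<in> carrier M" for x
    using h_basis[of "\<one>\<^bsub>F\<^esub>" x] that u by simp
  \<comment> \<open>Multiplicativity is bilinear in the factors, so it is first proved with a basis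
    element on the left and then extended by induction on the left factor.\<close>
  have h_mult1: "h (basis_elt F x \<otimes>\<^bsub>MA\<^esub> f) = u x \<otimes>\<^bsub>B\<^esub> h f"
    if x: "x \<in> carrier M" and f: "f \<in> carrier MA" for x f
    using f
  proof (induction f rule: MA_induct)
    case (add c y f)
    then show ?case
      using x u
      by (simp add: MA_bilinear MA_mult_closed MA_basis_mult h_add h_smult h_basis h_u h_closed
          u_mult B.r_distr B.smult_mult_right)
  qed (use x u in \<open>simp add: h_zero MA_bilinear\<close>)
  have h_mult: "h (f \<otimes>\<^bsub>MA\<^esub> g) = h f \<otimes>\<^bsub>B\<^esub> h g"
    if f: "f \<in> carrier MA" and g: "g \<in> carrier MA" for f g
    using f
  proof (induction f rule: MA_induct)
    case (add c y f)
    then show ?case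
      using g u
      by (simp add: MA_bilinear MA_mult_closed h_add h_smult h_mult1 h_basis h_u h_closed
          B.l_distr B.smult_mult_left)
  qed (use g h_closed in \<open>simp add: h_zero MA_bilinear\<close>)
  have "h \<in> alg_hom F MA B"
    by (rule alg_homI) (simp_all add: h_closed h_add h_mult h_smult MA_one h_u u_one)
  then show ?thesis using h_u that by blast
qed

end

lemma rcos_eq_quot_zero:
  assumes "assoc_algebra F A" "ideal J A" "x \<in> J"
  shows "J +>\<^bsub>A\<^esub> x = \<zero>\<^bsub>alg_quot A J\<^esub>"
proof -
  interpret A: assoc_algebra F A by fact
  interpret J: ideal J A by fact
  show ?thesis using assms(3) by (simp add: alg_quot_def FactRing_def J.a_rcos_const)
qed

section \<open>Functoriality of the tensor product\<close>

locale algebra_family =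
  fixes F :: "('f, 'm) ring_scheme" and K :: "'i set" and B :: "'i \<Rightarrow> ('f, 'a, 'k) module_scheme"
  assumes cring: "cring F" and algebras: "\<And>k. k \<in> K \<Longrightarrow> assoc_algebra F (B k)"
begin

sublocale T: cring_monoid F "product_group K B"
proof -
  have "monoid (B k)" if "k \<in> K" for k
    using algebras[OF that] by (simp add: assoc_algebra_def ring_def)
  then have "monoid (product_group K B)"
    by (intro monoidI) (auto simp: PiE_def Pi_def extensional_def fun_eq_iff
        monoid.m_closed monoid.one_closed monoid.m_assoc monoid.l_one monoid.r_one)
  then show "cring_monoid F (product_group K B)"
    using cring by (rule cring_monoid.intro[rotated])
qed

abbreviation J where "J \<equiv> Idl\<^bsub>T.MA\<^esub> (tensor_relators F K B)"

abbreviation pure where "pure x \<equiv> J +>\<^bsub>T.MA\<^esub> basis_elt F x"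

lemma upd_closed:
  "\<lbrakk>x \<in> (\<Pi>\<^sub>E k\<in>K. carrier (B k)); k \<in> K; a \<in> carrier (B k)\<rbrakk> \<Longrightarrow>
    x(k := a) \<in> (\<Pi>\<^sub>E k\<in>K. carrier (B k))"
  by (auto simp: PiE_def Pi_def extensional_def)

lemma add_closed: "k \<in> K \<Longrightarrow> a \<in> carrier (B k) \<Longrightarrow> b \<in> carrier (B k) \<Longrightarrow> a \<oplus>\<^bsub>B k\<^esub> b \<in> carrier (B k)"
  and smult_closed: "k \<in> K \<Longrightarrow> c \<in> carrier F \<Longrightarrow> a \<in> carrier (B k) \<Longrightarrow> c \<odot>\<^bsub>B k\<^esub> a \<in> carrier (B k)"
  using algebras[of k] by (auto simp: assoc_algebra_def module_def module_axioms_def ring_def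
      abelian_group_def abelian_monoid.a_closed)

lemma MA_ring: "ring T.MA"
  using T.MA_assoc_algebra by (simp add: assoc_algebra_def)

lemma relators_closed: "tensor_relators F K B \<subseteq> carrier T.MA"
  unfolding tensor_relators_def Let_def
  by (auto intro!: ring.ring_simprules(1,4)[OF MA_ring] T.MA_smult_closed T.MA_basis_closed
      simp del: fun_upd_apply simp: upd_closed add_closed smult_closed)

lemma J_ideal: "ideal J T.MA"
  using MA_ring relators_closed by (rule ring.genideal_ideal)

lemma tensor_alg_eq: "tensor_alg F K B = alg_quot T.MA J"
  by (simp add: tensor_alg_def Let_def)

lemma tensor_algebra: "assoc_algebra F (tensor_alg F K B)"
  unfolding tensor_alg_eq using T.MA_assoc_algebra J_ideal by (rule assoc_algebra.quot_algebra)

text \<open>The basis elements span the free module, so their classes, the pure tensors, span the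
  tensor product.\<close>

lemma tensor_hom_eq:
  assumes C: "assoc_algebra F C"
    and h: "h \<in> alg_hom F (tensor_alg F K B) C" and g: "g \<in> alg_hom F (tensor_alg F K B) C"
    and eq: "\<And>x. x \<in> (\<Pi>\<^sub>E k\<in>K. carrier (B k)) \<Longrightarrow> h (pure x) = g (pure x)"
    and y: "y \<in> carrier (tensor_alg F K B)"
  shows "h y = g y"
proof -
  interpret R: assoc_algebra F T.MA by (rule T.MA_assoc_algebra)
  obtain f where f: "f \<in> carrier T.MA" "y = J +>\<^bsub>T.MA\<^esub> f"
    using y by (auto simp: tensor_alg_eq R.quot_carrier)
  have q: "(\<lambda>x. J +>\<^bsub>T.MA\<^esub> x) \<in> alg_hom F T.MA (tensor_alg F K B)"
    unfolding tensor_alg_eq by (rule R.quot_hom[OF J_ideal])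
  show ?thesis
    unfolding f(2) using eq
    by (intro T.MA_hom_eq[OF C alg_hom_comp[OF q h] alg_hom_comp[OF q g] _ f(1)]) simp
qed

end

text \<open>Applying the \<open>h k\<close> coordinatewise is multiplicative on the product monoid,
  so it extends to the free module. It descends to the quotient because additivity and linearity of
  each \<open>h k\<close> turn a multilinearity relator into a multilinearity relator.\<close>

lemma tensor_map:
  assumes B: "algebra_family F K B" and C: "algebra_family F K C"
    and h: "\<And>k. k \<in> K \<Longrightarrow> h k \<in> alg_hom F (B k) (C k)"
  obtains H where "H \<in> alg_hom F (tensor_alg F K B) (tensor_alg F K C)"
    "\<And>x. x \<in> (\<Pi>\<^sub>E k\<in>K. carrier (B k)) \<Longrightarrow>
      H (algebra_family.pure F K B x) = algebra_family.pure F K C (\<lambda>k\<in>K. h k (x k))"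
proof -
  interpret B: algebra_family F K B by fact
  interpret C: algebra_family F K C by fact
  interpret RB: assoc_algebra F B.T.MA by (rule B.T.MA_assoc_algebra)
  interpret RC: assoc_algebra F C.T.MA by (rule C.T.MA_assoc_algebra)
  interpret TC: assoc_algebra F "tensor_alg F K C" by (rule C.tensor_algebra)
  let ?h = "\<lambda>x. \<lambda>k\<in>K. h k (x k)"
  have hc: "?h x \<in> (\<Pi>\<^sub>E k\<in>K. carrier (C k))" if "x \<in> (\<Pi>\<^sub>E k\<in>K. carrier (B k))" for x
    using that alg_homD(1)[OF h] by (auto simp: PiE_def Pi_def)
  have pc: "C.pure x \<in> carrier (tensor_alg F K C)" if "x \<in> (\<Pi>\<^sub>E k\<in>K. carrier (C k))" for x
    using that C.T.MA_basis_closed[of x] by (simp add: C.tensor_alg_eq RC.quot_carrier)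
  have pc_mult: "C.pure x \<otimes>\<^bsub>tensor_alg F K C\<^esub> C.pure y = C.pure (\<lambda>k\<in>K. x k \<otimes>\<^bsub>C k\<^esub> y k)"
    if "x \<in> (\<Pi>\<^sub>E k\<in>K. carrier (C k))" "y \<in> (\<Pi>\<^sub>E k\<in>K. carrier (C k))" for x y
    using that C.T.MA_basis_closed[of x] C.T.MA_basis_closed[of y] C.T.MA_basis_mult[of x y]
    by (simp add: C.tensor_alg_eq RC.quot_simps[OF C.J_ideal])
  obtain H0 where H0: "H0 \<in> alg_hom F B.T.MA (tensor_alg F K C)"
    and H0b: "\<And>x. x \<in> carrier (product_group K B) \<Longrightarrow> H0 (basis_elt F x) = C.pure (?h x)"
  proof (rule B.T.MA_lift[OF C.tensor_algebra])
    show "C.pure (?h x) \<in> carrier (tensor_alg F K C)" if "x \<in> carrier (product_group K B)" for x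
      using pc[OF hc, of x] that by simp
    show "C.pure (?h (x \<otimes>\<^bsub>product_group K B\<^esub> y)) =
        C.pure (?h x) \<otimes>\<^bsub>tensor_alg F K C\<^esub> C.pure (?h y)"
      if x: "x \<in> carrier (product_group K B)" and y: "y \<in> carrier (product_group K B)" for x y
    proof -
      have "?h (x \<otimes>\<^bsub>product_group K B\<^esub> y) = (\<lambda>k\<in>K. ?h x k \<otimes>\<^bsub>C k\<^esub> ?h y k)"
        using x y by (auto simp: restrict_def fun_eq_iff PiE_def Pi_def alg_homD[OF h])
      then show ?thesis using x y pc_mult[OF hc hc, of x y] by simp
    qed
    have "?h \<one>\<^bsub>product_group K B\<^esub> = \<one>\<^bsub>product_group K C\<^esub>"
      by (auto simp: restrict_def fun_eq_iff alg_homD[OF h])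
    then show "C.pure (?h \<one>\<^bsub>product_group K B\<^esub>) = \<one>\<^bsub>tensor_alg F K C\<^esub>"
      by (simp add: C.tensor_alg_eq RC.quot_one C.T.MA_one)
  qed blast
  \<comment> \<open>Changing one coordinate commutes with the coordinatewise map; this is what
    carries the shape of a relator over to the other side.\<close>
  have upd: "?h (x(k := a)) = (?h x)(k := h k a)" if "k \<in> K" for x k a
    using that by (auto simp: fun_eq_iff)
  have q: "(\<lambda>x. C.J +>\<^bsub>C.T.MA\<^esub> x) \<in> alg_hom F C.T.MA (tensor_alg F K C)"
    unfolding C.tensor_alg_eq by (rule RC.quot_hom[OF C.J_ideal])
  note min = alg_hom_minus[OF B.T.MA_assoc_algebra C.tensor_algebra H0]
    alg_hom_minus[OF C.T.MA_assoc_algebra C.tensor_algebra q]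
  have zero: "C.J +>\<^bsub>C.T.MA\<^esub> r = \<zero>\<^bsub>tensor_alg F K C\<^esub>" if "r \<in> tensor_relators F K C" for r
    unfolding C.tensor_alg_eq using that RC.genideal_self[OF C.relators_closed]
    by (intro rcos_eq_quot_zero[OF C.T.MA_assoc_algebra C.J_ideal]) blast
  have rel: "H0 r = \<zero>\<^bsub>tensor_alg F K C\<^esub>" if r: "r \<in> tensor_relators F K B" for r
  proof -
    consider (add) x k a b where "r = basis_elt F (x(k := a \<oplus>\<^bsub>B k\<^esub> b)) \<ominus>\<^bsub>B.T.MA\<^esub>
          (basis_elt F (x(k := a)) \<oplus>\<^bsub>B.T.MA\<^esub> basis_elt F (x(k := b)))"
          "x \<in> (\<Pi>\<^sub>E k\<in>K. carrier (B k))" "k \<in> K" "a \<in> carrier (B k)" "b \<in> carrier (B k)"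
      | (smult) x k c a where "r = basis_elt F (x(k := c \<odot>\<^bsub>B k\<^esub> a)) \<ominus>\<^bsub>B.T.MA\<^esub>
          c \<odot>\<^bsub>B.T.MA\<^esub> basis_elt F (x(k := a))"
          "x \<in> (\<Pi>\<^sub>E k\<in>K. carrier (B k))" "k \<in> K" "c \<in> carrier F" "a \<in> carrier (B k)"
      using r unfolding tensor_relators_def Let_def by blast
    then show ?thesis
    proof cases
      case add
      note hk = alg_homD[OF h[OF add(3)]]
      define x' where "x' = ?h x"
      have x': "x' \<in> (\<Pi>\<^sub>E k\<in>K. carrier (C k))" and upd': "?h (x(k := d)) = x'(k := h k d)" for d
        unfolding x'_def using hc[OF add(2)] upd[OF add(3)] by simp_all
      \<comment> \<open>The relator for \<open>C\<close> at the image point \<open>x'\<close>, with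
        entries \<open>h k a\<close> and \<open>h k b\<close>: its class is the value of
        \<open>H0\<close> at \<open>r\<close>, and that class is zero.\<close>
      let ?r = "basis_elt F (x'(k := h k a \<oplus>\<^bsub>C k\<^esub> h k b)) \<ominus>\<^bsub>C.T.MA\<^esub>
          (basis_elt F (x'(k := h k a)) \<oplus>\<^bsub>C.T.MA\<^esub> basis_elt F (x'(k := h k b)))"
      have "?r \<in> tensor_relators F K C"
        using add(2-5) x' hk(1) unfolding tensor_relators_def Let_def by blast
      moreover have "H0 r = C.J +>\<^bsub>C.T.MA\<^esub> ?r"
        using add(2-5) x'
        by (simp add: add(1) min alg_homD[OF H0] alg_homD[OF q] H0b upd' hk
            B.upd_closed B.add_closed C.upd_closed C.add_closed
            B.T.MA_basis_closed C.T.MA_basis_closed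
            del: fun_upd_apply)
      ultimately show ?thesis using zero by simp
    next
      case smult
      note hk = alg_homD[OF h[OF smult(3)]]
      define x' where "x' = ?h x"
      have x': "x' \<in> (\<Pi>\<^sub>E k\<in>K. carrier (C k))" and upd': "?h (x(k := d)) = x'(k := h k d)" for d
        unfolding x'_def using hc[OF smult(2)] upd[OF smult(3)] by simp_all
      let ?r = "basis_elt F (x'(k := c \<odot>\<^bsub>C k\<^esub> h k a)) \<ominus>\<^bsub>C.T.MA\<^esub>
          c \<odot>\<^bsub>C.T.MA\<^esub> basis_elt F (x'(k := h k a))"
      have "?r \<in> tensor_relators F K C"
        using smult(2-5) x' hk(1) unfolding tensor_relators_def Let_def by blast
      moreover have "H0 r = C.J +>\<^bsub>C.T.MA\<^esub> ?r"
        using smult(2-5) x'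
        by (simp add: smult(1) min alg_homD[OF H0] alg_homD[OF q] H0b upd' hk
            B.upd_closed B.smult_closed C.upd_closed C.smult_closed
            B.T.MA_basis_closed C.T.MA_basis_closed
            del: fun_upd_apply)
      ultimately show ?thesis using zero by simp
    qed
  qed
  obtain H where H: "H \<in> alg_hom F (alg_quot B.T.MA B.J) (tensor_alg F K C)"
    "\<And>x. x \<in> carrier B.T.MA \<Longrightarrow> H (B.J +>\<^bsub>B.T.MA\<^esub> x) = H0 x"
    using RB.quot_lift[OF C.tensor_algebra H0 B.relators_closed rel] by blast
  show ?thesis
  proof (rule that)
    show "H \<in> alg_hom F (tensor_alg F K B) (tensor_alg F K C)"
      using H(1) by (simp add: B.tensor_alg_eq)
  qed (simp add: H(2) H0b)
qed

text \<open>Functoriality is applied to the isomorphisms and to their inverses; both composites fix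
  pure tensors and are therefore the identity.\<close>

lemma tensor_alg_cong:
  assumes B: "algebra_family F K B" and C: "algebra_family F K C"
    and iso: "\<And>k. k \<in> K \<Longrightarrow> alg_iso F (B k) (C k)"
  shows "alg_iso F (tensor_alg F K B) (tensor_alg F K C)"
proof -
  interpret B: algebra_family F K B by fact
  interpret C: algebra_family F K C by fact
  \<comment> \<open>Both maps and all their properties sit in one predicate, so that a single choice
    over \<open>k\<close> selects matching pairs.\<close>
  define P where "P k h g \<longleftrightarrow> h \<in> alg_hom F (B k) (C k) \<and> g \<in> alg_hom F (C k) (B k) \<and>
      (\<forall>x\<in>carrier (B k). g (h x) = x) \<and> (\<forall>y\<in>carrier (C k). h (g y) = y)" for k h g
  have "\<exists>h g. P k h g" if "k \<in> K" for k
    unfolding P_def using alg_isoE[OF iso[OF that] B.algebras[OF that]] by metis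
  then obtain h g where "\<And>k. k \<in> K \<Longrightarrow> P k (h k) (g k)" by metis
  then have h: "\<And>k. k \<in> K \<Longrightarrow> h k \<in> alg_hom F (B k) (C k)"
    and g: "\<And>k. k \<in> K \<Longrightarrow> g k \<in> alg_hom F (C k) (B k)"
    and gh: "\<And>k x. k \<in> K \<Longrightarrow> x \<in> carrier (B k) \<Longrightarrow> g k (h k x) = x"
    and hg: "\<And>k x. k \<in> K \<Longrightarrow> x \<in> carrier (C k) \<Longrightarrow> h k (g k x) = x"
    by (auto simp: P_def)
  obtain H where H: "H \<in> alg_hom F (tensor_alg F K B) (tensor_alg F K C)"
    and Hp: "\<And>x. x \<in> (\<Pi>\<^sub>E k\<in>K. carrier (B k)) \<Longrightarrow> H (B.pure x) = C.pure (\<lambda>k\<in>K. h k (x k))"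
    by (rule tensor_map[OF B C h]) blast+
  obtain G where G: "G \<in> alg_hom F (tensor_alg F K C) (tensor_alg F K B)"
    and Gp: "\<And>x. x \<in> (\<Pi>\<^sub>E k\<in>K. carrier (C k)) \<Longrightarrow> G (C.pure x) = B.pure (\<lambda>k\<in>K. g k (x k))"
    by (rule tensor_map[OF C B g]) blast+
  show ?thesis
  proof (rule alg_isoI[OF H G])
    fix y assume y: "y \<in> carrier (tensor_alg F K B)"
    show "G (H y) = y"
    proof (rule B.tensor_hom_eq[OF B.tensor_algebra alg_hom_comp[OF H G] alg_hom_id _ y])
      fix x assume x: "x \<in> (\<Pi>\<^sub>E k\<in>K. carrier (B k))"
      have "(\<lambda>k\<in>K. h k (x k)) \<in> (\<Pi>\<^sub>E k\<in>K. carrier (C k))"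
        using x alg_homD(1)[OF h] by (auto simp: PiE_def Pi_def)
      moreover have "(\<lambda>k\<in>K. g k ((\<lambda>k\<in>K. h k (x k)) k)) = x"
        using x gh by (auto simp: restrict_def fun_eq_iff PiE_def Pi_def extensional_def)
      ultimately show "G (H (B.pure x)) = B.pure x" using x by (simp add: Hp Gp)
    qed
  next
    fix y assume y: "y \<in> carrier (tensor_alg F K C)"
    show "H (G y) = y"
    proof (rule C.tensor_hom_eq[OF C.tensor_algebra alg_hom_comp[OF G H] alg_hom_id _ y])
      fix x assume x: "x \<in> (\<Pi>\<^sub>E k\<in>K. carrier (C k))"
      have "(\<lambda>k\<in>K. g k (x k)) \<in> (\<Pi>\<^sub>E k\<in>K. carrier (B k))"
        using x alg_homD(1)[OF g] by (auto simp: PiE_def Pi_def)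
      moreover have "(\<lambda>k\<in>K. h k ((\<lambda>k\<in>K. g k (x k)) k)) = x"
        using x hg by (auto simp: restrict_def fun_eq_iff PiE_def Pi_def extensional_def)
      ultimately show "H (G (C.pure x)) = C.pure x" using x by (simp add: Hp Gp)
    qed
  qed
qed

section \<open>Cyclic algebras\<close>

lemma words_monoid: "cring F \<Longrightarrow> cring_monoid F \<lparr>carrier = UNIV, monoid.mult = (@), one = []\<rparr>"
  by (intro cring_monoid.intro monoidI) auto

lemma free_algebra_algebra: "cring F \<Longrightarrow> assoc_algebra F (free_algebra F)"
  unfolding free_algebra_def by (intro cring_monoid.MA_assoc_algebra words_monoid)

lemma free_gen_closed: "cring F \<Longrightarrow> basis_elt F ws \<in> carrier (free_algebra F)"
  unfolding free_algebra_def by (simp add: cring_monoid.MA_basis_closed[OF words_monoid])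

text \<open>A word goes to the product of the images of its letters. This is a monoid homomorphism,
  hence extends to the monoid algebra of words.\<close>

lemma free_lift:
  assumes F: "cring F" and B: "assoc_algebra F B" and u: "\<And>g. u g \<in> carrier B"
  obtains h where "h \<in> alg_hom F (free_algebra F) B" "\<And>g. h (basis_elt F [g]) = u g"
proof -
  interpret W: cring_monoid F "\<lparr>carrier = UNIV, monoid.mult = (@), one = []\<rparr>"
    using F by (rule words_monoid)
  interpret B: assoc_algebra F B by fact
  define v where "v ws = foldr (\<lambda>g r. u g \<otimes>\<^bsub>B\<^esub> r) ws \<one>\<^bsub>B\<^esub>" for ws
  have v: "v ws \<in> carrier B" for ws
    by (induction ws) (auto simp: v_def u)
  have v_append: "v (ws @ ws') = v ws \<otimes>\<^bsub>B\<^esub> v ws'" for ws ws'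
    using v[of ws'] v by (induction ws) (simp_all add: v_def u B.m_assoc)
  obtain h where "h \<in> alg_hom F W.MA B" "\<And>ws. h (basis_elt F ws) = v ws"
    using W.MA_lift[OF B, of v] v v_append by (auto simp: v_def)
  then show ?thesis using that[of h] u by (simp add: free_algebra_def v_def)
qed

lemma free_hom_eq:
  assumes F: "cring F" and B: "assoc_algebra F B"
    and h: "h \<in> alg_hom F (free_algebra F) B" and g: "g \<in> alg_hom F (free_algebra F) B"
    and eq: "\<And>x. h (basis_elt F [x]) = g (basis_elt F [x])"
    and f: "f \<in> carrier (free_algebra F)"
  shows "h f = g f"
proof -
  interpret W: cring_monoid F "\<lparr>carrier = UNIV, monoid.mult = (@), one = []\<rparr>"
    using F by (rule words_monoid)
  note hg = h[unfolded free_algebra_def] g[unfolded free_algebra_def]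
  have "h (basis_elt F ws) = g (basis_elt F ws)" for ws
  proof (induction ws)
    case Nil
    show ?case using alg_homD(4)[OF hg(1)] alg_homD(4)[OF hg(2)] by (simp add: W.MA_one)
  next
    case (Cons x ws)
    have "basis_elt F (x # ws) = basis_elt F [x] \<otimes>\<^bsub>W.MA\<^esub> basis_elt F ws"
      by (simp add: W.MA_basis_mult)
    then show ?case by (simp add: alg_homD[OF hg(1)] alg_homD[OF hg(2)] Cons eq)
  qed
  then show ?thesis
    by (rule W.MA_hom_eq[OF B hg _ f[unfolded free_algebra_def]])
qed

text \<open>Such pairs in \<open>A\<close> are exactly the images of the two generators under
  homomorphisms from \<open>[\<alpha>,\<beta>)\<close> to \<open>A\<close>. The pair need not
  generate \<open>A\<close>.\<close>

definition cyclic_pair ::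
  "nat \<Rightarrow> ('f, 'm) ring_scheme \<Rightarrow> ('f, 'a, 'k) module_scheme \<Rightarrow> 'f \<Rightarrow> 'f \<Rightarrow> 'a \<Rightarrow> 'a \<Rightarrow> bool" where
  "cyclic_pair p F A \<alpha> \<beta> x y \<longleftrightarrow> x \<in> carrier A \<and> y \<in> carrier A \<and>
     x [^]\<^bsub>A\<^esub> p \<ominus>\<^bsub>A\<^esub> x = \<alpha> \<odot>\<^bsub>A\<^esub> \<one>\<^bsub>A\<^esub> \<and> y [^]\<^bsub>A\<^esub> p = \<beta> \<odot>\<^bsub>A\<^esub> \<one>\<^bsub>A\<^esub> \<and>
     y \<otimes>\<^bsub>A\<^esub> x = (x \<ominus>\<^bsub>A\<^esub> \<one>\<^bsub>A\<^esub>) \<otimes>\<^bsub>A\<^esub> y"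

locale cyclic_algebra =
  fixes p :: nat and F :: "('f, 'm) ring_scheme" and \<alpha> \<beta> :: 'f
  assumes cring: "cring F" and \<alpha>: "\<alpha> \<in> carrier F" and \<beta>: "\<beta> \<in> carrier F"
begin

abbreviation C where "C \<equiv> cyclic_alg p F \<alpha> \<beta>"

abbreviation J where "J \<equiv> Idl\<^bsub>free_algebra F\<^esub> (cyclic_relators p F \<alpha> \<beta>)"

definition gi where "gi = J +>\<^bsub>free_algebra F\<^esub> basis_elt F [GenI]"

definition gj where "gj = J +>\<^bsub>free_algebra F\<^esub> basis_elt F [GenJ]"

sublocale R: assoc_algebra F "free_algebra F"
  using cring by (rule free_algebra_algebra)

lemma gen_closed [simp]: "basis_elt F ws \<in> carrier (free_algebra F)"
  using cring by (rule free_gen_closed)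

lemma relators_closed: "cyclic_relators p F \<alpha> \<beta> \<subseteq> carrier (free_algebra F)"
  using \<alpha> \<beta> by (auto simp: cyclic_relators_def Let_def)

lemma J_ideal: "ideal J (free_algebra F)"
  using relators_closed by (rule R.genideal_ideal)

lemma cyclic_alg_algebra: "assoc_algebra F C"
  unfolding cyclic_alg_def using J_ideal by (rule R.quot_algebra)

sublocale C: assoc_algebra F C
  by (rule cyclic_alg_algebra)

lemma proj_hom: "(\<lambda>x. J +>\<^bsub>free_algebra F\<^esub> x) \<in> alg_hom F (free_algebra F) C"
  unfolding cyclic_alg_def using J_ideal by (rule R.quot_hom)

lemma pair_gens: "cyclic_pair p F C \<alpha> \<beta> gi gj"
proof -
  note q = alg_homD[OF proj_hom] alg_hom_minus[OF R.assoc_algebra_axioms cyclic_alg_algebra proj_hom]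
    alg_hom_pow[OF R.assoc_algebra_axioms cyclic_alg_algebra proj_hom]
  have gi: "gi \<in> carrier C" and gj: "gj \<in> carrier C"
    by (simp_all add: gi_def gj_def q)
  have zero: "J +>\<^bsub>free_algebra F\<^esub> r = \<zero>\<^bsub>C\<^esub>" if "r \<in> cyclic_relators p F \<alpha> \<beta>" for r
    unfolding cyclic_alg_def using that R.genideal_self[OF relators_closed]
    by (intro rcos_eq_quot_zero[OF R.assoc_algebra_axioms J_ideal]) blast
  let ?i = "basis_elt F [GenI]" and ?j = "basis_elt F [GenJ]"
  have "(?i [^]\<^bsub>free_algebra F\<^esub> p \<ominus>\<^bsub>free_algebra F\<^esub> ?i) \<ominus>\<^bsub>free_algebra F\<^esub> \<alpha> \<odot>\<^bsub>free_algebra F\<^esub> \<one>\<^bsub>free_algebra F\<^esub> \<in> cyclic_relators p F \<alpha> \<beta>"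
    and "?j [^]\<^bsub>free_algebra F\<^esub> p \<ominus>\<^bsub>free_algebra F\<^esub> \<beta> \<odot>\<^bsub>free_algebra F\<^esub> \<one>\<^bsub>free_algebra F\<^esub> \<in> cyclic_relators p F \<alpha> \<beta>"
    and "?j \<otimes>\<^bsub>free_algebra F\<^esub> ?i \<ominus>\<^bsub>free_algebra F\<^esub> (?i \<ominus>\<^bsub>free_algebra F\<^esub> \<one>\<^bsub>free_algebra F\<^esub>) \<otimes>\<^bsub>free_algebra F\<^esub> ?j \<in> cyclic_relators p F \<alpha> \<beta>"
    by (simp_all add: cyclic_relators_def Let_def)
  note this[THEN zero]
  then have "(gi [^]\<^bsub>C\<^esub> p \<ominus>\<^bsub>C\<^esub> gi) \<ominus>\<^bsub>C\<^esub> \<alpha> \<odot>\<^bsub>C\<^esub> \<one>\<^bsub>C\<^esub> = \<zero>\<^bsub>C\<^esub>"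
    and "gj [^]\<^bsub>C\<^esub> p \<ominus>\<^bsub>C\<^esub> \<beta> \<odot>\<^bsub>C\<^esub> \<one>\<^bsub>C\<^esub> = \<zero>\<^bsub>C\<^esub>"
    and "gj \<otimes>\<^bsub>C\<^esub> gi \<ominus>\<^bsub>C\<^esub> (gi \<ominus>\<^bsub>C\<^esub> \<one>\<^bsub>C\<^esub>) \<otimes>\<^bsub>C\<^esub> gj = \<zero>\<^bsub>C\<^esub>"
    using \<alpha> \<beta> by (simp_all add: q gi_def gj_def)
  then show ?thesis
    using gi gj \<alpha> \<beta> by (simp add: cyclic_pair_def C.r_right_minus_eq)
qed

text \<open>A map from the free algebra with the prescribed values on letters kills the three
  relators precisely because the values form a cyclic pair.\<close>

lemma lift:
  assumes B: "assoc_algebra F B" and xy: "cyclic_pair p F B \<alpha> \<beta> x y"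
  obtains h where "h \<in> alg_hom F C B" "h gi = x" "h gj = y"
proof -
  interpret B: assoc_algebra F B by fact
  note xy' = xy[unfolded cyclic_pair_def]
  define u where "u g = (case g of GenI \<Rightarrow> x | GenJ \<Rightarrow> y)" for g
  have u: "u g \<in> carrier B" for g
    using xy' by (cases g) (auto simp: u_def)
  obtain h where h: "h \<in> alg_hom F (free_algebra F) B" and hb: "\<And>g. h (basis_elt F [g]) = u g"
    by (rule free_lift[OF cring B, of u, OF u]) blast
  note hs = alg_homD[OF h] alg_hom_minus[OF R.assoc_algebra_axioms B h]
    alg_hom_pow[OF R.assoc_algebra_axioms B h]
  have "h r = \<zero>\<^bsub>B\<^esub>" if "r \<in> cyclic_relators p F \<alpha> \<beta>" for r
    using that xy' \<alpha> \<beta> by (auto simp: cyclic_relators_def Let_def hs hb u_def B.r_right_minus_eq)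
  then obtain g where g: "g \<in> alg_hom F C B"
    "\<And>x. x \<in> carrier (free_algebra F) \<Longrightarrow> g (J +>\<^bsub>free_algebra F\<^esub> x) = h x"
    using R.quot_lift[OF B h relators_closed] unfolding cyclic_alg_def by blast
  then show ?thesis using that[of g] by (simp add: gi_def gj_def hb u_def)
qed

lemma hom_eq:
  assumes B: "assoc_algebra F B" and h: "h \<in> alg_hom F C B" and g: "g \<in> alg_hom F C B"
    and eq: "h gi = g gi" "h gj = g gj" and z: "z \<in> carrier C"
  shows "h z = g z"
proof -
  obtain f where f: "f \<in> carrier (free_algebra F)" "z = J +>\<^bsub>free_algebra F\<^esub> f"
    using z by (auto simp: cyclic_alg_def R.quot_carrier)
  have "h (J +>\<^bsub>free_algebra F\<^esub> basis_elt F [x]) = g (J +>\<^bsub>free_algebra F\<^esub> basis_elt F [x])" for x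
    using eq by (cases x) (simp_all add: gi_def gj_def)
  then show ?thesis
    unfolding f(2)
    by (intro free_hom_eq[OF cring B alg_hom_comp[OF proj_hom h] alg_hom_comp[OF proj_hom g] _ f(1)])
qed

end

text \<open>The pairs define homomorphisms in both directions. The last two premises say that the
  composites fix the generators; they range over all homomorphisms with the given values, since the
  actual maps come into existence only inside the proof.\<close>

lemma cyclic_alg_isoI:
  assumes C: "cyclic_algebra F \<alpha> \<beta>" and D: "cyclic_algebra F \<alpha>' \<beta>'"
    and x': "cyclic_pair p F (cyclic_alg p F \<alpha> \<beta>) \<alpha>' \<beta>' x' y'"
    and x: "cyclic_pair p F (cyclic_alg p F \<alpha>' \<beta>') \<alpha> \<beta> x y"
    and h: "\<And>h. \<lbrakk>h \<in> alg_hom F (cyclic_alg p F \<alpha>' \<beta>') (cyclic_alg p F \<alpha> \<beta>);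
        h (cyclic_algebra.gi p F \<alpha>' \<beta>') = x'; h (cyclic_algebra.gj p F \<alpha>' \<beta>') = y'\<rbrakk> \<Longrightarrow>
        h x = cyclic_algebra.gi p F \<alpha> \<beta> \<and> h y = cyclic_algebra.gj p F \<alpha> \<beta>"
    and g: "\<And>g. \<lbrakk>g \<in> alg_hom F (cyclic_alg p F \<alpha> \<beta>) (cyclic_alg p F \<alpha>' \<beta>');
        g (cyclic_algebra.gi p F \<alpha> \<beta>) = x; g (cyclic_algebra.gj p F \<alpha> \<beta>) = y\<rbrakk> \<Longrightarrow>
        g x' = cyclic_algebra.gi p F \<alpha>' \<beta>' \<and> g y' = cyclic_algebra.gj p F \<alpha>' \<beta>'"
  shows "alg_iso F (cyclic_alg p F \<alpha> \<beta>) (cyclic_alg p F \<alpha>' \<beta>')"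
proof -
  interpret C: cyclic_algebra p F \<alpha> \<beta> by fact
  interpret D: cyclic_algebra p F \<alpha>' \<beta>' by fact
  obtain h where h': "h \<in> alg_hom F D.C C.C" "h D.gi = x'" "h D.gj = y'"
    using D.lift[OF C.cyclic_alg_algebra x'] .
  obtain g where g': "g \<in> alg_hom F C.C D.C" "g C.gi = x" "g C.gj = y"
    using C.lift[OF D.cyclic_alg_algebra x] .
  show ?thesis
  proof (rule alg_isoI[OF g'(1) h'(1)])
    show "h (g z) = z" if "z \<in> carrier C.C" for z
      using h[OF h'] g'(2,3)
      by (intro C.hom_eq[OF C.cyclic_alg_algebra alg_hom_comp[OF g'(1) h'(1)] alg_hom_id _ _ that])
        simp_all
    show "g (h z) = z" if "z \<in> carrier D.C" for z
      using g[OF g'] h'(2,3)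
      by (intro D.hom_eq[OF D.cyclic_alg_algebra alg_hom_comp[OF h'(1) g'(1)] alg_hom_id _ _ that])
        simp_all
  qed
qed

section \<open>Falling factorials in characteristic \<open>p\<close>\<close>

text \<open>A polynomial over the field with p elements that has more roots than its degree is zero.
  Working in Z[X], this reads as divisibility by the constant p; the induction splits off one root
  by synthetic division.\<close>

lemma prime_dvd_coeff_if_dvd_values:
  fixes f :: "int poly"
  assumes p: "Factorial_Ring.prime p"
    and "Polynomial.degree f \<le> n" "n < p" "\<And>m. m \<le> n \<Longrightarrow> int p dvd poly f (int m)"
  shows "[:int p:] dvd f"
  using assms(2-)
proof (induction n arbitrary: f)
  case 0
  then have "f = [:poly f 0:]" by (metis degree_0_id le_zero_eq poly_0_coeff_0)
  moreover have "int p dvd poly f 0" using "0.prems"(3)[of 0] by simp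
  ultimately show ?case by (metis const_poly_dvd_const_poly_iff)
next
  case (Suc n)
  let ?c = "int (Suc n)"
  let ?g = "synthetic_div f ?c"
  have f: "f = [:- ?c, 1:] * ?g + [:poly f ?c:]"
    by (rule synthetic_div_correct'[symmetric])
  have "[:int p:] dvd ?g"
  proof (rule Suc.IH)
    show "Polynomial.degree ?g \<le> n" using Suc.prems by (simp add: degree_synthetic_div)
    show "n < p" using Suc.prems by simp
    fix m assume m: "m \<le> n"
    have "poly f (int m) = (int m - ?c) * poly ?g (int m) + poly f ?c"
      by (subst (1) f) (simp add: algebra_simps)
    moreover have "int p dvd poly f (int m)" "int p dvd poly f ?c"
      using Suc.prems(3)[of m] Suc.prems(3)[of "Suc n"] m by simp_all
    ultimately have "int p dvd (int m - ?c) * poly ?g (int m)"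
      by (metis dvd_add_left_iff)
    \<comment> \<open>The difference is negative with absolute value at most
      \<open>n + 1 < p\<close>, so p must divide the other factor.\<close>
    moreover have "\<not> int p dvd int m - ?c"
      using m Suc.prems(2) zdvd_not_zless[of "?c - int m" "int p"] by (simp add: dvd_diff_commute)
    ultimately show "int p dvd poly ?g (int m)"
      using p prime_dvd_mult_iff[of "int p"] by simp
  qed
  moreover have "[:int p:] dvd [:poly f ?c:]"
    using Suc.prems(3)[of "Suc n"] by (simp add: const_poly_dvd_const_poly_iff)
  ultimately show ?case by (subst f) (intro dvd_add dvd_mult)
qed

text \<open>By Fermat both polynomials vanish modulo p at 0, ..., p-1. Both are monic of degree p,
  so their difference has degree less than p and is zero modulo p.\<close>

lemma falling_poly_cong:
  assumes p: "Factorial_Ring.prime p"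
  shows "[:int p:] dvd (\<Prod>m<p. [:- int m, 1:]) - (Polynomial.monom 1 p - Polynomial.monom 1 1)"
proof -
  let ?P = "\<Prod>m<p. [:- int m, 1:]" and ?X = "Polynomial.monom 1 p - Polynomial.monom 1 1 :: int poly"
  have p1: "1 < p" using p by (rule prime_gt_1_nat)
  have degP: "Polynomial.degree ?P = p"
    by (subst degree_prod_sum_eq) auto
  have "Polynomial.coeff ?P p = 1"
    using lead_coeff_prod[of "\<lambda>m. [:- int m, 1:]" "{..<p}"] by (simp add: degP)
  then have "Polynomial.coeff (?P - ?X) p = 0" using p1 by simp
  moreover have "Polynomial.degree (?P - ?X) \<le> p"
    using p1 degP by (intro degree_diff_le) (auto simp: degree_monom_eq intro: degree_diff_le)
  \<comment> \<open>Without the cancellation of the leading terms the degree would be p, and the p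
    available values would not suffice.\<close>
  ultimately have "Polynomial.degree (?P - ?X) \<le> p - 1"
    using eq_zero_or_degree_less[of "?P - ?X" p] by auto
  then show ?thesis
  proof (rule prime_dvd_coeff_if_dvd_values[OF p])
    show "p - 1 < p" using p1 by simp
    fix m assume m: "m \<le> p - 1"
    have "poly ?P (int m) = 0"
      using m p1 by (auto simp: poly_prod intro!: prod_zero bexI[of _ m])
    moreover have "int p dvd int m ^ p - int m"
    proof (cases "p dvd m")
      case True
      then show ?thesis using p1 by (metis dvd_diff dvd_power_le of_nat_dvd_iff less_imp_le power_one_right)
    next
      case False
      then have "[m ^ (p - 1) = 1] (mod p)" using p by (rule fermat_theorem[rotated])
      then have "[m ^ (p - 1) * m = 1 * m] (mod p)" by (rule cong_scalar_right)
      then have "[m ^ p = m] (mod p)" using p1 by (simp add: power_eq_if mult.commute)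
      then show ?thesis
        by (metis cong_iff_dvd_diff cong_int_iff of_nat_power)
    qed
    ultimately show "int p dvd poly (?P - ?X) (int m)"
      by (simp add: poly_monom dvd_minus_iff dvd_diff_commute)
  qed
qed

section \<open>Falling factorials in a ring, by evaluating integer polynomials\<close>

context ring
begin

primrec ffact :: "'a \<Rightarrow> nat \<Rightarrow> 'a" where
  "ffact x 0 = \<one>"
| "ffact x (Suc n) = ffact x n \<otimes> (x \<ominus> [n] \<cdot> \<one>)"

lemma ffact_closed [simp]: "x \<in> carrier R \<Longrightarrow> ffact x n \<in> carrier R"
  by (induction n) auto

lemma add_pow_int_zero: "[(0::int)] \<cdot> x = \<zero>"
  by (simp add: add_pow_def)

text \<open>Horner evaluation at \<open>x\<close>, a map from Z[X] to \<open>R\<close>. It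
  transports the congruence of integer polynomials into an arbitrary ring of characteristic
  p.\<close>

definition int_eval :: "'a \<Rightarrow> int poly \<Rightarrow> 'a" where
  "int_eval x f = fold_coeffs (\<lambda>c r. [c] \<cdot> \<one> \<oplus> x \<otimes> r) f \<zero>"

lemma int_eval_pCons:
  assumes "x \<in> carrier R"
  shows "int_eval x 0 = \<zero>" "int_eval x (pCons c f) = [c] \<cdot> \<one> \<oplus> x \<otimes> int_eval x f"
proof -
  show 0: "int_eval x 0 = \<zero>" by (simp add: int_eval_def)
  show "int_eval x (pCons c f) = [c] \<cdot> \<one> \<oplus> x \<otimes> int_eval x f"
  proof (cases "c = 0 \<and> f = 0")
    case True
    then show ?thesis using assms 0 by (simp add: add_pow_int_zero)
  next
    case False
    then show ?thesis by (auto simp: int_eval_def)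
  qed
qed

lemma int_eval_closed [simp]: "x \<in> carrier R \<Longrightarrow> int_eval x f \<in> carrier R"
  by (induction f) (auto simp: int_eval_pCons)

lemma int_eval_add:
  assumes x: "x \<in> carrier R" shows "int_eval x (f + g) = int_eval x f \<oplus> int_eval x g"
proof (induction f g rule: poly_induct2)
  case (pCons a f b g)
  then show ?case
    using x by (simp add: int_eval_pCons add.int_pow_mult r_distr a_ac)
qed (use x in \<open>simp add: int_eval_pCons\<close>)

lemma int_eval_smult:
  assumes x: "x \<in> carrier R" shows "int_eval x (Polynomial.smult c f) = [c] \<cdot> int_eval x f"
proof (induction f)
  case (pCons a f)
  then show ?case
    using x by (simp add: int_eval_pCons add.int_pow_distrib add.int_pow_pow mult.commute
        add_pow_rdistr_int)
qed (use x in \<open>simp add: int_eval_pCons\<close>)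

lemma int_eval_monom:
  assumes x: "x \<in> carrier R" shows "int_eval x (Polynomial.monom 1 n) = x [^] n"
proof (induction n)
  case (Suc n)
  then show ?case using x nat_pow_mult[OF x, of 1 n] by (simp add: monom_Suc int_eval_pCons add_pow_int_zero)
qed (use x in \<open>simp add: monom_0 int_eval_pCons\<close>)

lemma ffact_commute: "x \<in> carrier R \<Longrightarrow> x \<otimes> ffact x n = ffact x n \<otimes> x"
proof (induction n)
  case (Suc n)
  have "x \<otimes> (x \<ominus> [n] \<cdot> \<one>) = (x \<ominus> [n] \<cdot> \<one>) \<otimes> x"
    using Suc.prems by (simp add: a_minus_def r_distr l_distr r_minus l_minus add_pow_ldistr add_pow_rdistr)
  then show ?case
    using Suc by (simp add: m_assoc[symmetric]) (simp add: m_assoc)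
qed simp

text \<open>The factor \<open>X - n\<close> acts on the product \<open>P\<close> as
  \<open>X P - n P\<close>, so linearity and the Horner step suffice. Commuting \<open>x\<close>
  with \<open>ffact x n\<close> puts the new factor on the right.\<close>

lemma int_eval_falling:
  assumes x: "x \<in> carrier R" shows "int_eval x (\<Prod>m<n. [:- int m, 1:]) = ffact x n"
proof (induction n)
  case (Suc n)
  let ?P = "\<Prod>m<n. [:- int m, 1:]"
  have "(\<Prod>m<Suc n. [:- int m, 1:]) = pCons 0 ?P + Polynomial.smult (- int n) ?P"
    by (simp add: mult.commute)
  then have "int_eval x (\<Prod>m<Suc n. [:- int m, 1:]) = x \<otimes> ffact x n \<oplus> [(- int n)] \<cdot> ffact x n"
    using x Suc by (simp only: int_eval_add int_eval_smult int_eval_pCons) (simp add: add_pow_int_zero)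
  also have "[(- int n)] \<cdot> ffact x n = \<ominus> ([n] \<cdot> ffact x n)"
    using x by (simp add: add.int_pow_neg_int)
  finally show ?case
    using x by (simp add: ffact_commute a_minus_def r_distr r_minus add_pow_rdistr)
qed (use x in \<open>simp add: int_eval_pCons one_pCons\<close>)

lemma char_dvd_zero:
  assumes p: "[p] \<cdot> \<one> = \<zero>" and "p dvd m" and y: "y \<in> carrier R"
  shows "[(m::nat)] \<cdot> y = \<zero>"
proof -
  obtain k where "m = p * k" using \<open>p dvd m\<close> by blast
  then have "[m] \<cdot> \<one> = [k] \<cdot> ([p] \<cdot> \<one>)" by (simp add: add.nat_pow_pow)
  then have "[m] \<cdot> \<one> = \<zero>" using p by simp
  then show ?thesis using add_pow_ldistr[of \<one> y m] y by simp
qed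

text \<open>Evaluation at \<open>x\<close> of the congruence X(X-1)...(X-p+1) = X^p - X modulo p:
  the multiple of p evaluates to zero.\<close>

lemma ffact_prime:
  assumes p: "Factorial_Ring.prime p" "[p] \<cdot> \<one> = \<zero>" and x: "x \<in> carrier R"
  shows "ffact x p = x [^] p \<ominus> x"
proof -
  let ?P = "\<Prod>m<p. [:- int m, 1:]" and ?X = "Polynomial.monom 1 p - Polynomial.monom 1 1 :: int poly"
  obtain g where "?P - ?X = [:int p:] * g"
    using falling_poly_cong[OF p(1)] by blast
  then have eq: "?P = Polynomial.smult (int p) g + (Polynomial.monom 1 p + Polynomial.smult (- 1) (Polynomial.monom 1 1))"
    by (simp add: algebra_simps)
  have "[int p] \<cdot> int_eval x g = \<zero>"
    using char_dvd_zero[OF p(2), of p] x by (simp add: add_pow_int_ge)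
  then have "int_eval x ?P = x [^] p \<oplus> \<ominus> x"
    unfolding eq int_eval_add[OF x] int_eval_smult[OF x] int_eval_monom[OF x]
    using x add.int_pow_neg_int[of x 1] by simp
  then show ?thesis using x by (simp add: int_eval_falling a_minus_def)
qed

section \<open>Powers of sums and products of noncommuting elements\<close>

lemma pascal_sum:
  assumes E: "\<And>a b. E a b \<in> carrier R"
  shows "(\<Oplus>k\<in>{..n}. [(n choose k)] \<cdot> (E (Suc n - k) k \<oplus> E (n - k) (Suc k))) =
    (\<Oplus>k\<in>{..Suc n}. [(Suc n choose k)] \<cdot> E (Suc n - k) k)"
proof -
  let ?T = "\<lambda>m k. [(m choose k)] \<cdot> E (Suc n - k) k"
  \<comment> \<open>The term k = 0 is split off so that Pascal's rule applies to the index
    \<open>Suc k\<close> in all others.\<close>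
  have "(\<Oplus>k\<in>{..Suc n}. ?T (Suc n) k) = (\<Oplus>k\<in>{..n}. ?T (Suc n) (Suc k)) \<oplus> ?T (Suc n) 0"
    using E by (subst finsum_Suc2) auto
  also have "(\<Oplus>k\<in>{..n}. ?T (Suc n) (Suc k)) =
      (\<Oplus>k\<in>{..n}. [(n choose k)] \<cdot> E (n - k) (Suc k) \<oplus> ?T n (Suc k))"
    using E by (intro finsum_cong') (auto simp: add.nat_pow_mult)
  also have "\<dots> = (\<Oplus>k\<in>{..n}. [(n choose k)] \<cdot> E (n - k) (Suc k)) \<oplus> (\<Oplus>k\<in>{..n}. ?T n (Suc k))"
    using E by (intro finsum_addf) auto
  also have "\<dots> \<oplus> ?T (Suc n) 0 = (\<Oplus>k\<in>{..n}. [(n choose k)] \<cdot> E (n - k) (Suc k)) \<oplus>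
      ((\<Oplus>k\<in>{..n}. ?T n (Suc k)) \<oplus> ?T n 0)"
    using E by (subst a_assoc) auto
  also have "(\<Oplus>k\<in>{..n}. ?T n (Suc k)) \<oplus> ?T n 0 = (\<Oplus>k\<in>{..Suc n}. ?T n k)"
    using E by (subst finsum_Suc2) auto
  \<comment> \<open>The extra term k = n + 1 carries the binomial coefficient zero.\<close>
  also have "\<dots> = (\<Oplus>k\<in>{..n}. ?T n k)"
    using E by (subst finsum_Suc) (auto simp: binomial_eq_0)
  also have "(\<Oplus>k\<in>{..n}. [(n choose k)] \<cdot> E (n - k) (Suc k)) \<oplus> (\<Oplus>k\<in>{..n}. ?T n k) =
      (\<Oplus>k\<in>{..n}. [(n choose k)] \<cdot> E (n - k) (Suc k) \<oplus> ?T n k)"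
    using E by (intro finsum_addf[symmetric]) auto
  also have "\<dots> = (\<Oplus>k\<in>{..n}. [(n choose k)] \<cdot> (E (Suc n - k) k \<oplus> E (n - k) (Suc k)))"
    using E by (intro finsum_cong') (auto simp: add.nat_pow_distrib a_comm)
  finally show ?thesis by simp
qed

text \<open>
  This covers both the Frobenius map (\<open>E a b = x\<^sup>a w\<^sup>b\<close>) and, for \<open>w x = (x + 1) w\<close>, the falling
  factorials: with \<open>E a b = x (x - 1) \<dots> (x - a + 1) w\<^sup>b\<close> one has
  \<open>E a b (x + w - (a + b)) = E (a + 1) b + E a (b + 1)\<close>, which replaces Jacobson's formula.
\<close>

lemma binomial_prime:
  fixes p :: nat
  assumes p: "Factorial_Ring.prime p" "[p] \<cdot> \<one> = \<zero>"
    and E: "\<And>a b. E a b \<in> carrier R" and t: "\<And>n. t n \<in> carrier R"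
    and Q: "Q 0 = E 0 0" "\<And>n. Q (Suc n) = Q n \<otimes> t n"
    and step: "\<And>a b. E a b \<otimes> t (a + b) = E (Suc a) b \<oplus> E a (Suc b)"
  shows "Q p = E p 0 \<oplus> E 0 p"
proof -
  have Qn: "Q n = (\<Oplus>k\<in>{..n}. [(n choose k)] \<cdot> E (n - k) k)" for n
  proof (induction n)
    case 0
    show ?case using E Q by simp
  next
    case (Suc n)
    have "Q (Suc n) = (\<Oplus>k\<in>{..n}. [(n choose k)] \<cdot> E (n - k) k \<otimes> t n)"
      using E t by (simp add: Q Suc finsum_ldistr)
    also have "\<dots> = (\<Oplus>k\<in>{..n}. [(n choose k)] \<cdot> (E (Suc n - k) k \<oplus> E (n - k) (Suc k)))"
    proof (intro finsum_cong')
      fix k assume "k \<in> {..n}"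
      then show "[(n choose k)] \<cdot> E (n - k) k \<otimes> t n =
          [(n choose k)] \<cdot> (E (Suc n - k) k \<oplus> E (n - k) (Suc k))"
        using E t step[of "n - k" k] by (simp add: add_pow_ldistr Suc_diff_le)
    qed (use E in auto)
    also note pascal_sum[OF E]
    finally show ?case .
  qed
  have p2: "2 \<le> p" using p(1) by (rule prime_ge_2_nat)
  \<comment> \<open>The prime p divides all inner binomial coefficients, so only both ends survive;
    they are distinct indices since p is at least 2.\<close>
  have "Q p = (\<Oplus>k\<in>{0, p}. [(p choose k)] \<cdot> E (p - k) k)"
    unfolding Qn
  proof (rule add.finprod_mono_neutral_cong_right)
    fix k assume "k \<in> {..p} - {0, p}"
    then have "p dvd (p choose k)" using p(1) by (intro dvd_choose_prime) auto
    then show "[(p choose k)] \<cdot> E (p - k) k = \<zero>" using E by (rule char_dvd_zero[OF p(2)])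
  qed (use E in auto)
  also have "\<dots> = E p 0 \<oplus> E 0 p" using p2 E by simp
  finally show ?thesis .
qed

text \<open>Each factor \<open>w\<close> that passes \<open>x\<close> adds one \<open>d\<close>. The
  cases used are d = 0 (commuting elements), d = 1 and d = -1.\<close>

lemma pow_commute_shift:
  assumes xw: "x \<in> carrier R" "w \<in> carrier R" "d \<in> carrier R" and c: "w \<otimes> d = d \<otimes> w"
    and r: "w \<otimes> x = (x \<oplus> d) \<otimes> w"
  shows "w [^] (k::nat) \<otimes> x = (x \<oplus> [k] \<cdot> d) \<otimes> w [^] k"
proof (induction k)
  case (Suc k)
  have wd: "w [^] k \<otimes> d = d \<otimes> w [^] k" using xw c pow_mult_distrib
    by (metis group_commutes_pow)
  have "w [^] Suc k \<otimes> x = w [^] k \<otimes> (w \<otimes> x)"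
    using xw by (simp add: m_assoc)
  also have "\<dots> = (w [^] k \<otimes> x \<oplus> w [^] k \<otimes> d) \<otimes> w"
    using xw by (simp add: r m_assoc[symmetric] r_distr)
  also have "\<dots> = (x \<oplus> [Suc k] \<cdot> d) \<otimes> w [^] Suc k"
    using xw by (simp add: Suc wd l_distr m_assoc a_assoc add_pow_ldistr)
  finally show ?case .
qed (use xw in simp)

lemma frobenius_add:
  fixes p :: nat
  assumes p: "Factorial_Ring.prime p" "[p] \<cdot> \<one> = \<zero>"
    and xw: "x \<in> carrier R" "w \<in> carrier R" and c: "w \<otimes> x = x \<otimes> w"
  shows "(x \<oplus> w) [^] p = x [^] p \<oplus> w [^] p"
proof -
  have "(x \<oplus> w) [^] p = x [^] p \<otimes> w [^] (0::nat) \<oplus> x [^] (0::nat) \<otimes> w [^] p"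
  proof (rule binomial_prime[OF p])
    fix a b :: nat
    have wx: "w [^] b \<otimes> x = x \<otimes> w [^] b"
      using pow_commute_shift[of x w \<zero> b] xw c by simp
    have "x [^] a \<otimes> w [^] b \<otimes> (x \<oplus> w) = x [^] a \<otimes> (w [^] b \<otimes> x) \<oplus> x [^] a \<otimes> (w [^] b \<otimes> w)"
      using xw by (simp add: r_distr m_assoc)
    then show "x [^] a \<otimes> w [^] b \<otimes> (x \<oplus> w) = x [^] Suc a \<otimes> w [^] b \<oplus> x [^] a \<otimes> w [^] Suc b"
      using xw by (simp add: wx m_assoc)
  qed (use xw in auto)
  then show ?thesis using xw by simp
qed

text \<open>At n = p the falling factorials of \<open>x + w\<close> and of \<open>x\<close> are the
  Artin-Schreier expressions on both sides, so a binomial expansion of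
  \<open>ffact (x \<oplus> w) p\<close> is the whole content.\<close>

lemma artin_schreier_shift:
  fixes p :: nat
  assumes p: "Factorial_Ring.prime p" "[p] \<cdot> \<one> = \<zero>"
    and xw: "x \<in> carrier R" "w \<in> carrier R" and r: "w \<otimes> x = (x \<oplus> \<one>) \<otimes> w"
  shows "(x \<oplus> w) [^] p \<ominus> (x \<oplus> w) = (x [^] p \<ominus> x) \<oplus> w [^] p"
proof -
  have "ffact (x \<oplus> w) p = ffact x p \<otimes> w [^] (0::nat) \<oplus> ffact x 0 \<otimes> w [^] p"
  proof (rule binomial_prime[OF p])
    fix a b :: nat
    let ?n = "[(a + b)] \<cdot> \<one>"
    have n: "?n = [a] \<cdot> \<one> \<oplus> [b] \<cdot> \<one>" by (simp add: add.nat_pow_mult)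
    have wn: "w [^] b \<otimes> ?n = ?n \<otimes> w [^] b"
      using xw by (simp add: add_pow_ldistr add_pow_rdistr)
    have "w [^] b \<otimes> (x \<oplus> w \<ominus> ?n) = w [^] b \<otimes> x \<ominus> w [^] b \<otimes> ?n \<oplus> w [^] b \<otimes> w"
      using xw by (simp add: a_minus_def r_distr r_minus a_ac)
    also have "w [^] b \<otimes> x = (x \<oplus> [b] \<cdot> \<one>) \<otimes> w [^] b"
      using xw r by (intro pow_commute_shift) auto
    \<comment> \<open>Passing \<open>w^b\<close> has turned \<open>x\<close> into
      \<open>x + b\<close>. This cancels the \<open>b\<close> in \<open>a + b\<close> and leaves
      \<open>x - a\<close>, the next factor of \<open>ffact x a\<close>.\<close>
    also have "(x \<oplus> [b] \<cdot> \<one>) \<otimes> w [^] b \<ominus> w [^] b \<otimes> ?n = (x \<ominus> [a] \<cdot> \<one>) \<otimes> w [^] b"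
    proof -
      have "x \<oplus> [b] \<cdot> \<one> \<ominus> ?n = x \<ominus> [a] \<cdot> \<one>"
        using xw by (simp add: n a_minus_def minus_add a_ac r_neg2 r_neg1 r_neg)
      then show ?thesis
        using xw unfolding wn by (simp add: a_minus_def l_distr l_minus flip: l_minus l_distr)
    qed
    finally have 1: "w [^] b \<otimes> (x \<oplus> w \<ominus> ?n) = (x \<ominus> [a] \<cdot> \<one>) \<otimes> w [^] b \<oplus> w [^] b \<otimes> w" .
    have "ffact x a \<otimes> w [^] b \<otimes> (x \<oplus> w \<ominus> ?n) = ffact x a \<otimes> (w [^] b \<otimes> (x \<oplus> w \<ominus> ?n))"
      using xw by (simp add: m_assoc)
    also have "\<dots> = ffact x (Suc a) \<otimes> w [^] b \<oplus> ffact x a \<otimes> w [^] Suc b"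
      unfolding 1 using xw by (simp add: r_distr m_assoc)
    finally show "ffact x a \<otimes> w [^] b \<otimes> (x \<oplus> w \<ominus> ?n) =
        ffact x (Suc a) \<otimes> w [^] b \<oplus> ffact x a \<otimes> w [^] Suc b" .
  qed (use xw in auto)
  then show ?thesis using xw p by (simp add: ffact_prime)
qed

text \<open>Moving \<open>y^n\<close> past the next \<open>x\<close> gives \<open>x - n\<close>,
  again the next falling factor. At n = p the result is \<open>(x^p - x) y^p\<close>, the source of
  the product of both slots.\<close>

lemma norm_pow:
  assumes xy: "x \<in> carrier R" "y \<in> carrier R" and r: "y \<otimes> x = (x \<ominus> \<one>) \<otimes> y"
  shows "(x \<otimes> y) [^] (n::nat) = ffact x n \<otimes> y [^] n"
proof (induction n)
  case (Suc n)
  have "y [^] n \<otimes> x = (x \<oplus> [n] \<cdot> (\<ominus> \<one>)) \<otimes> y [^] n"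
    using xy r by (intro pow_commute_shift) (auto simp: a_minus_def l_minus r_minus)
  also have "[n] \<cdot> (\<ominus> \<one>) = \<ominus> ([n] \<cdot> \<one>)" by (simp add: add.nat_pow_inv)
  finally have s: "y [^] n \<otimes> x = (x \<ominus> [n] \<cdot> \<one>) \<otimes> y [^] n" by (simp add: a_minus_def)
  have "(x \<otimes> y) [^] Suc n = ffact x n \<otimes> (y [^] n \<otimes> x) \<otimes> y"
    using xy by (simp add: Suc m_assoc)
  then show ?case using xy by (simp add: s m_assoc)
qed (use xy in simp)

end

section \<open>Isomorphisms between cyclic \<open>p\<close>-algebras\<close>

locale char_p_field = field F for F (structure) +
  fixes p :: nat
  assumes prime: "Factorial_Ring.prime p" and char: "[p] \<cdot>\<^bsub>F\<^esub> \<one>\<^bsub>F\<^esub> = \<zero>\<^bsub>F\<^esub>"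
begin

text \<open>Deduced from additivity of the Frobenius map, which treats p = 2 and odd p
  alike.\<close>

lemma neg_pow_p: "c \<in> carrier F \<Longrightarrow> (\<ominus>\<^bsub>F\<^esub> c) [^]\<^bsub>F\<^esub> p = \<ominus>\<^bsub>F\<^esub> (c [^]\<^bsub>F\<^esub> p)"
proof -
  assume c: "c \<in> carrier F"
  have "\<zero>\<^bsub>F\<^esub> = ((\<ominus>\<^bsub>F\<^esub> c) \<oplus>\<^bsub>F\<^esub> c) [^]\<^bsub>F\<^esub> p"
    using c prime_gt_0_nat[OF prime] by (simp add: l_neg nat_pow_zero)
  also have "\<dots> = (\<ominus>\<^bsub>F\<^esub> c) [^]\<^bsub>F\<^esub> p \<oplus>\<^bsub>F\<^esub> c [^]\<^bsub>F\<^esub> p"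
    using c by (intro frobenius_add[OF prime char]) (auto simp: m_comm)
  finally show ?thesis using c by (metis a_inv_closed minus_equality nat_pow_closed)
qed

lemma cyclic_algebraI [intro]: "\<alpha> \<in> carrier F \<Longrightarrow> \<beta> \<in> carrier F \<Longrightarrow> cyclic_algebra F \<alpha> \<beta>"
  by (intro cyclic_algebra.intro is_cring)

end

section \<open>Changes of generators inside an algebra\<close>

locale char_p_algebra = char_p_field F p + A: assoc_algebra F A
  for F (structure) and p and A (structure)
begin

lemma char_A: "[p] \<cdot>\<^bsub>A\<^esub> \<one>\<^bsub>A\<^esub> = \<zero>\<^bsub>A\<^esub>"
proof -
  have "[n] \<cdot>\<^bsub>A\<^esub> \<one>\<^bsub>A\<^esub> = ([n] \<cdot>\<^bsub>F\<^esub> \<one>\<^bsub>F\<^esub>) \<odot>\<^bsub>A\<^esub> \<one>\<^bsub>A\<^esub>" for n :: nat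
    by (induction n) (simp_all add: A.smult_l_distr)
  then show ?thesis using char by simp
qed

lemma smult_pow:
  "c \<in> carrier F \<Longrightarrow> x \<in> carrier A \<Longrightarrow> (c \<odot>\<^bsub>A\<^esub> x) [^]\<^bsub>A\<^esub> (n::nat) = (c [^]\<^bsub>F\<^esub> n) \<odot>\<^bsub>A\<^esub> (x [^]\<^bsub>A\<^esub> n)"
proof (induction n)
  case (Suc n)
  then show ?case
    by (simp add: A.smult_mult_left A.smult_mult_right A.smult_assoc1[symmetric] m_comm)
qed simp

text \<open>The added scalar is central: the p-th power splits by Frobenius, and the commutation
  relation is unaffected.\<close>

lemma pair_translate:
  assumes xy: "cyclic_pair p F A \<alpha> \<beta> x y" and c: "c \<in> carrier F" and \<alpha>: "\<alpha> \<in> carrier F"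
  shows "cyclic_pair p F A (\<alpha> \<oplus>\<^bsub>F\<^esub> (c [^]\<^bsub>F\<^esub> p \<ominus>\<^bsub>F\<^esub> c)) \<beta> (x \<oplus>\<^bsub>A\<^esub> c \<odot>\<^bsub>A\<^esub> \<one>\<^bsub>A\<^esub>) y"
proof -
  have x: "x \<in> carrier A" and y: "y \<in> carrier A"
    and xp: "x [^]\<^bsub>A\<^esub> p \<ominus>\<^bsub>A\<^esub> x = \<alpha> \<odot>\<^bsub>A\<^esub> \<one>\<^bsub>A\<^esub>" and yp: "y [^]\<^bsub>A\<^esub> p = \<beta> \<odot>\<^bsub>A\<^esub> \<one>\<^bsub>A\<^esub>"
    and yx: "y \<otimes>\<^bsub>A\<^esub> x = (x \<ominus>\<^bsub>A\<^esub> \<one>\<^bsub>A\<^esub>) \<otimes>\<^bsub>A\<^esub> y"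
    using xy by (auto simp: cyclic_pair_def)
  let ?c = "c \<odot>\<^bsub>A\<^esub> \<one>\<^bsub>A\<^esub>"
  have cA: "?c \<in> carrier A" using c by simp
  have "?c \<otimes>\<^bsub>A\<^esub> x = x \<otimes>\<^bsub>A\<^esub> ?c" and cy: "y \<otimes>\<^bsub>A\<^esub> ?c = ?c \<otimes>\<^bsub>A\<^esub> y"
    using c x y by (simp_all add: A.smult_mult_left A.smult_mult_right)
  then have "(x \<oplus>\<^bsub>A\<^esub> ?c) [^]\<^bsub>A\<^esub> p = x [^]\<^bsub>A\<^esub> p \<oplus>\<^bsub>A\<^esub> ?c [^]\<^bsub>A\<^esub> p"
    using x cA by (intro A.frobenius_add[OF prime char_A])
  then have "(x \<oplus>\<^bsub>A\<^esub> ?c) [^]\<^bsub>A\<^esub> p \<ominus>\<^bsub>A\<^esub> (x \<oplus>\<^bsub>A\<^esub> ?c) = (x [^]\<^bsub>A\<^esub> p \<ominus>\<^bsub>A\<^esub> x) \<oplus>\<^bsub>A\<^esub> (?c [^]\<^bsub>A\<^esub> p \<ominus>\<^bsub>A\<^esub> ?c)"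
    using x cA by (simp add: a_minus_def A.minus_add A.a_ac)
  also have "\<dots> = (\<alpha> \<oplus>\<^bsub>F\<^esub> (c [^]\<^bsub>F\<^esub> p \<ominus>\<^bsub>F\<^esub> c)) \<odot>\<^bsub>A\<^esub> \<one>\<^bsub>A\<^esub>"
    unfolding xp using c \<alpha> by (simp add: smult_pow A.smult_l_distr a_minus_def A.smult_l_minus)
  finally have 1: "(x \<oplus>\<^bsub>A\<^esub> ?c) [^]\<^bsub>A\<^esub> p \<ominus>\<^bsub>A\<^esub> (x \<oplus>\<^bsub>A\<^esub> ?c) =
      (\<alpha> \<oplus>\<^bsub>F\<^esub> (c [^]\<^bsub>F\<^esub> p \<ominus>\<^bsub>F\<^esub> c)) \<odot>\<^bsub>A\<^esub> \<one>\<^bsub>A\<^esub>" .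
  have 2: "y \<otimes>\<^bsub>A\<^esub> (x \<oplus>\<^bsub>A\<^esub> ?c) = ((x \<oplus>\<^bsub>A\<^esub> ?c) \<ominus>\<^bsub>A\<^esub> \<one>\<^bsub>A\<^esub>) \<otimes>\<^bsub>A\<^esub> y"
    using x y cA by (simp add: A.r_distr A.l_distr yx cy a_minus_def A.a_ac)
  show ?thesis
    unfolding cyclic_pair_def using 1 2 x y cA yp by simp
qed

text \<open>The summand \<open>w = c y^(p-1)\<close> behaves like a multiple of the inverse of
  \<open>y\<close>: it commutes with \<open>y\<close> and satisfies \<open>w x = (x + 1) w\<close>.
  Hence \<open>x^p - x\<close> changes by exactly \<open>w^p\<close>.\<close>

lemma pair_add:
  assumes xy: "cyclic_pair p F A \<alpha> \<beta> x y" and c: "c \<in> carrier F"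
    and \<alpha>: "\<alpha> \<in> carrier F" and \<beta>: "\<beta> \<in> carrier F"
  shows "cyclic_pair p F A (\<alpha> \<oplus>\<^bsub>F\<^esub> c [^]\<^bsub>F\<^esub> p \<otimes>\<^bsub>F\<^esub> \<beta> [^]\<^bsub>F\<^esub> (p - 1)) \<beta>
    (x \<oplus>\<^bsub>A\<^esub> c \<odot>\<^bsub>A\<^esub> y [^]\<^bsub>A\<^esub> (p - 1)) y"
proof -
  have x: "x \<in> carrier A" and y: "y \<in> carrier A"
    and xp: "x [^]\<^bsub>A\<^esub> p \<ominus>\<^bsub>A\<^esub> x = \<alpha> \<odot>\<^bsub>A\<^esub> \<one>\<^bsub>A\<^esub>" and yp: "y [^]\<^bsub>A\<^esub> p = \<beta> \<odot>\<^bsub>A\<^esub> \<one>\<^bsub>A\<^esub>"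
    and yx: "y \<otimes>\<^bsub>A\<^esub> x = (x \<ominus>\<^bsub>A\<^esub> \<one>\<^bsub>A\<^esub>) \<otimes>\<^bsub>A\<^esub> y"
    using xy by (auto simp: cyclic_pair_def)
  have p0: "p = Suc (p - 1)" using prime_gt_0_nat[OF prime] by simp
  let ?v = "y [^]\<^bsub>A\<^esub> (p - 1)"
  let ?w = "c \<odot>\<^bsub>A\<^esub> ?v"
  have w: "?w \<in> carrier A" using c y by simp
  have "[p] \<cdot>\<^bsub>A\<^esub> (\<ominus>\<^bsub>A\<^esub> \<one>\<^bsub>A\<^esub>) = \<zero>\<^bsub>A\<^esub>"
    by (rule A.char_dvd_zero[OF char_A]) auto
  then have "[(p - 1)] \<cdot>\<^bsub>A\<^esub> (\<ominus>\<^bsub>A\<^esub> \<one>\<^bsub>A\<^esub>) \<oplus>\<^bsub>A\<^esub> (\<ominus>\<^bsub>A\<^esub> \<one>\<^bsub>A\<^esub>) = \<zero>\<^bsub>A\<^esub>"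
    by (subst (asm) p0) simp
  \<comment> \<open>Passing \<open>y^(p-1)\<close> shifts \<open>x\<close> by -(p-1), which is 1 in
    characteristic p; this is why the exponent is p - 1.\<close>
  then have p1: "[(p - 1)] \<cdot>\<^bsub>A\<^esub> (\<ominus>\<^bsub>A\<^esub> \<one>\<^bsub>A\<^esub>) = \<one>\<^bsub>A\<^esub>"
    using A.minus_equality[of "[(p - 1)] \<cdot>\<^bsub>A\<^esub> (\<ominus>\<^bsub>A\<^esub> \<one>\<^bsub>A\<^esub>)" "\<ominus>\<^bsub>A\<^esub> \<one>\<^bsub>A\<^esub>"] by simp
  have "?v \<otimes>\<^bsub>A\<^esub> x = (x \<oplus>\<^bsub>A\<^esub> [(p - 1)] \<cdot>\<^bsub>A\<^esub> (\<ominus>\<^bsub>A\<^esub> \<one>\<^bsub>A\<^esub>)) \<otimes>\<^bsub>A\<^esub> ?v"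
    using x y yx by (intro A.pow_commute_shift) (auto simp: a_minus_def A.l_minus A.r_minus)
  then have "?w \<otimes>\<^bsub>A\<^esub> x = (x \<oplus>\<^bsub>A\<^esub> \<one>\<^bsub>A\<^esub>) \<otimes>\<^bsub>A\<^esub> ?w"
    using c x y by (simp add: p1 A.smult_mult_left A.smult_mult_right del: One_nat_def)
  then have "(x \<oplus>\<^bsub>A\<^esub> ?w) [^]\<^bsub>A\<^esub> p \<ominus>\<^bsub>A\<^esub> (x \<oplus>\<^bsub>A\<^esub> ?w) = (x [^]\<^bsub>A\<^esub> p \<ominus>\<^bsub>A\<^esub> x) \<oplus>\<^bsub>A\<^esub> ?w [^]\<^bsub>A\<^esub> p"
    using x w by (intro A.artin_schreier_shift[OF prime char_A])
  also have "?w [^]\<^bsub>A\<^esub> p = (c [^]\<^bsub>F\<^esub> p \<otimes>\<^bsub>F\<^esub> \<beta> [^]\<^bsub>F\<^esub> (p - 1)) \<odot>\<^bsub>A\<^esub> \<one>\<^bsub>A\<^esub>"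
  proof -
    have "?v [^]\<^bsub>A\<^esub> p = (y [^]\<^bsub>A\<^esub> p) [^]\<^bsub>A\<^esub> (p - 1)"
      using y by (simp add: A.nat_pow_pow mult.commute)
    then show ?thesis using c y \<beta> by (simp add: smult_pow yp A.smult_assoc1)
  qed
  finally have 1: "(x \<oplus>\<^bsub>A\<^esub> ?w) [^]\<^bsub>A\<^esub> p \<ominus>\<^bsub>A\<^esub> (x \<oplus>\<^bsub>A\<^esub> ?w) =
      (\<alpha> \<oplus>\<^bsub>F\<^esub> c [^]\<^bsub>F\<^esub> p \<otimes>\<^bsub>F\<^esub> \<beta> [^]\<^bsub>F\<^esub> (p - 1)) \<odot>\<^bsub>A\<^esub> \<one>\<^bsub>A\<^esub>"
    using c \<alpha> \<beta> by (simp add: xp A.smult_l_distr)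
  have "y \<otimes>\<^bsub>A\<^esub> ?v = ?v \<otimes>\<^bsub>A\<^esub> y"
    using y by (metis A.group_commutes_pow)
  then have wy: "y \<otimes>\<^bsub>A\<^esub> ?w = ?w \<otimes>\<^bsub>A\<^esub> y"
    using c y by (simp add: A.smult_mult_left A.smult_mult_right)
  have 2: "y \<otimes>\<^bsub>A\<^esub> (x \<oplus>\<^bsub>A\<^esub> ?w) = ((x \<oplus>\<^bsub>A\<^esub> ?w) \<ominus>\<^bsub>A\<^esub> \<one>\<^bsub>A\<^esub>) \<otimes>\<^bsub>A\<^esub> y"
    using x y w by (simp add: A.r_distr A.l_distr yx wy a_minus_def A.a_ac del: One_nat_def)
  show ?thesis
    unfolding cyclic_pair_def using 1 2 x y w yp by (simp del: One_nat_def)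
qed

text \<open>The inverse of \<open>x\<close>, read off from
  \<open>x (x^(p-1) - 1) = \<alpha>\<close>. As a polynomial in \<open>x\<close> it is carried along
  by homomorphisms.\<close>

definition as_inv :: "'a \<Rightarrow> 'c \<Rightarrow> 'c" where
  "as_inv \<alpha> x = inv\<^bsub>F\<^esub> \<alpha> \<odot>\<^bsub>A\<^esub> (x [^]\<^bsub>A\<^esub> (p - 1) \<ominus>\<^bsub>A\<^esub> \<one>\<^bsub>A\<^esub>)"

lemma as_inv:
  assumes x: "x \<in> carrier A" and xp: "x [^]\<^bsub>A\<^esub> p \<ominus>\<^bsub>A\<^esub> x = \<alpha> \<odot>\<^bsub>A\<^esub> \<one>\<^bsub>A\<^esub>"
    and \<alpha>: "\<alpha> \<in> carrier F - {\<zero>\<^bsub>F\<^esub>}"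
  shows "as_inv \<alpha> x \<in> carrier A" "as_inv \<alpha> x \<otimes>\<^bsub>A\<^esub> x = \<one>\<^bsub>A\<^esub>" "x \<otimes>\<^bsub>A\<^esub> as_inv \<alpha> x = \<one>\<^bsub>A\<^esub>"
proof -
  have p0: "p = Suc (p - 1)" using prime_gt_0_nat[OF prime] by simp
  have i: "inv\<^bsub>F\<^esub> \<alpha> \<in> carrier F" "inv\<^bsub>F\<^esub> \<alpha> \<otimes>\<^bsub>F\<^esub> \<alpha> = \<one>\<^bsub>F\<^esub>"
    using \<alpha> by (auto simp: field_Units)
  show "as_inv \<alpha> x \<in> carrier A" using i x by (simp add: as_inv_def)
  have xx: "x \<otimes>\<^bsub>A\<^esub> x [^]\<^bsub>A\<^esub> (p - 1) = x [^]\<^bsub>A\<^esub> (p - 1) \<otimes>\<^bsub>A\<^esub> x"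
    using x by (metis A.group_commutes_pow)
  have xs: "x [^]\<^bsub>A\<^esub> (p - 1) \<otimes>\<^bsub>A\<^esub> x = x [^]\<^bsub>A\<^esub> p"
    by (subst (2) p0) simp
  have "inv\<^bsub>F\<^esub> \<alpha> \<odot>\<^bsub>A\<^esub> (x [^]\<^bsub>A\<^esub> p \<ominus>\<^bsub>A\<^esub> x) = \<one>\<^bsub>A\<^esub>"
    using \<alpha> i by (simp add: xp A.smult_assoc1[symmetric])
  then show "as_inv \<alpha> x \<otimes>\<^bsub>A\<^esub> x = \<one>\<^bsub>A\<^esub>" "x \<otimes>\<^bsub>A\<^esub> as_inv \<alpha> x = \<one>\<^bsub>A\<^esub>"
    using x i by (simp_all add: as_inv_def A.smult_mult_left A.smult_mult_right
        a_minus_def A.l_distr A.r_distr A.l_minus A.r_minus xx xs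
        del: One_nat_def)
qed

text \<open>By \<open>norm_pow\<close> at p, \<open>(x y)^p = (x^p - x) y^p\<close>. The other
  relation survives because \<open>x\<close> commutes with \<open>x - 1\<close>.\<close>

lemma pair_mult:
  assumes xy: "cyclic_pair p F A \<alpha> \<beta> x y" and \<alpha>: "\<alpha> \<in> carrier F" and \<beta>: "\<beta> \<in> carrier F"
  shows "cyclic_pair p F A \<alpha> (\<alpha> \<otimes>\<^bsub>F\<^esub> \<beta>) x (x \<otimes>\<^bsub>A\<^esub> y)"
proof -
  have x: "x \<in> carrier A" and y: "y \<in> carrier A"
    and xp: "x [^]\<^bsub>A\<^esub> p \<ominus>\<^bsub>A\<^esub> x = \<alpha> \<odot>\<^bsub>A\<^esub> \<one>\<^bsub>A\<^esub>" and yp: "y [^]\<^bsub>A\<^esub> p = \<beta> \<odot>\<^bsub>A\<^esub> \<one>\<^bsub>A\<^esub>"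
    and yx: "y \<otimes>\<^bsub>A\<^esub> x = (x \<ominus>\<^bsub>A\<^esub> \<one>\<^bsub>A\<^esub>) \<otimes>\<^bsub>A\<^esub> y"
    using xy by (auto simp: cyclic_pair_def)
  have "(x \<otimes>\<^bsub>A\<^esub> y) [^]\<^bsub>A\<^esub> p = (\<alpha> \<otimes>\<^bsub>F\<^esub> \<beta>) \<odot>\<^bsub>A\<^esub> \<one>\<^bsub>A\<^esub>"
    using A.norm_pow[OF x y yx, of p] A.ffact_prime[OF prime char_A x] \<alpha> \<beta>
    by (simp add: xp yp A.smult_mult_left A.smult_assoc1)
  moreover have "x \<otimes>\<^bsub>A\<^esub> y \<otimes>\<^bsub>A\<^esub> x = (x \<ominus>\<^bsub>A\<^esub> \<one>\<^bsub>A\<^esub>) \<otimes>\<^bsub>A\<^esub> (x \<otimes>\<^bsub>A\<^esub> y)"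
  proof -
    have "x \<otimes>\<^bsub>A\<^esub> y \<otimes>\<^bsub>A\<^esub> x = (x \<otimes>\<^bsub>A\<^esub> (x \<ominus>\<^bsub>A\<^esub> \<one>\<^bsub>A\<^esub>)) \<otimes>\<^bsub>A\<^esub> y"
      using x y by (simp add: A.m_assoc yx)
    also have "x \<otimes>\<^bsub>A\<^esub> (x \<ominus>\<^bsub>A\<^esub> \<one>\<^bsub>A\<^esub>) = (x \<ominus>\<^bsub>A\<^esub> \<one>\<^bsub>A\<^esub>) \<otimes>\<^bsub>A\<^esub> x"
      using x by (simp add: a_minus_def A.l_distr A.r_distr A.l_minus A.r_minus)
    finally show ?thesis using x y by (simp add: A.m_assoc)
  qed
  ultimately show ?thesis
    unfolding cyclic_pair_def using x y xp by simp
qed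

text \<open>This reverses \<open>pair_mult\<close>. The power of \<open>z = x^(-1) y\<close> is
  found backwards: from \<open>y = x z\<close> one gets \<open>y^p = \<alpha> z^p\<close>, and
  \<open>\<alpha>\<close> is cancelled.\<close>

lemma pair_divide:
  assumes xy: "cyclic_pair p F A \<alpha> (\<alpha> \<otimes>\<^bsub>F\<^esub> \<beta>) x y"
    and \<alpha>: "\<alpha> \<in> carrier F - {\<zero>\<^bsub>F\<^esub>}" and \<beta>: "\<beta> \<in> carrier F"
  shows "cyclic_pair p F A \<alpha> \<beta> x (as_inv \<alpha> x \<otimes>\<^bsub>A\<^esub> y)"
proof -
  have x: "x \<in> carrier A" and y: "y \<in> carrier A"
    and xp: "x [^]\<^bsub>A\<^esub> p \<ominus>\<^bsub>A\<^esub> x = \<alpha> \<odot>\<^bsub>A\<^esub> \<one>\<^bsub>A\<^esub>"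
    and yp: "y [^]\<^bsub>A\<^esub> p = (\<alpha> \<otimes>\<^bsub>F\<^esub> \<beta>) \<odot>\<^bsub>A\<^esub> \<one>\<^bsub>A\<^esub>"
    and yx: "y \<otimes>\<^bsub>A\<^esub> x = (x \<ominus>\<^bsub>A\<^esub> \<one>\<^bsub>A\<^esub>) \<otimes>\<^bsub>A\<^esub> y"
    using xy by (auto simp: cyclic_pair_def)
  note u = as_inv[OF x xp \<alpha>]
  let ?u = "as_inv \<alpha> x"
  let ?z = "?u \<otimes>\<^bsub>A\<^esub> y"
  have z: "?z \<in> carrier A" using u y by simp
  have xz: "x \<otimes>\<^bsub>A\<^esub> ?z = y" using u x y by (simp add: A.m_assoc[symmetric])
  have zx: "?z \<otimes>\<^bsub>A\<^esub> x = (x \<ominus>\<^bsub>A\<^esub> \<one>\<^bsub>A\<^esub>) \<otimes>\<^bsub>A\<^esub> ?z"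
  proof -
    have "?z \<otimes>\<^bsub>A\<^esub> x = (?u \<otimes>\<^bsub>A\<^esub> (x \<ominus>\<^bsub>A\<^esub> \<one>\<^bsub>A\<^esub>)) \<otimes>\<^bsub>A\<^esub> y"
      using u x y by (simp add: A.m_assoc yx)
    also have "?u \<otimes>\<^bsub>A\<^esub> (x \<ominus>\<^bsub>A\<^esub> \<one>\<^bsub>A\<^esub>) = (x \<ominus>\<^bsub>A\<^esub> \<one>\<^bsub>A\<^esub>) \<otimes>\<^bsub>A\<^esub> ?u"
      using u x by (simp add: a_minus_def A.l_distr A.r_distr A.l_minus A.r_minus)
    finally show ?thesis using u x y by (simp add: A.m_assoc)
  qed
  have i: "inv\<^bsub>F\<^esub> \<alpha> \<in> carrier F" "inv\<^bsub>F\<^esub> \<alpha> \<otimes>\<^bsub>F\<^esub> \<alpha> = \<one>\<^bsub>F\<^esub>"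
    using \<alpha> by (auto simp: field_Units)
  have "(x \<otimes>\<^bsub>A\<^esub> ?z) [^]\<^bsub>A\<^esub> p = \<alpha> \<odot>\<^bsub>A\<^esub> ?z [^]\<^bsub>A\<^esub> p"
    using A.norm_pow[OF x z zx, of p] A.ffact_prime[OF prime char_A x] \<alpha> z
    by (simp add: xp A.smult_mult_left)
  then have "\<alpha> \<odot>\<^bsub>A\<^esub> ?z [^]\<^bsub>A\<^esub> p = \<alpha> \<odot>\<^bsub>A\<^esub> (\<beta> \<odot>\<^bsub>A\<^esub> \<one>\<^bsub>A\<^esub>)"
    using \<alpha> \<beta> by (simp add: xz yp A.smult_assoc1)
  then have "(inv\<^bsub>F\<^esub> \<alpha> \<otimes>\<^bsub>F\<^esub> \<alpha>) \<odot>\<^bsub>A\<^esub> ?z [^]\<^bsub>A\<^esub> p = (inv\<^bsub>F\<^esub> \<alpha> \<otimes>\<^bsub>F\<^esub> \<alpha>) \<odot>\<^bsub>A\<^esub> (\<beta> \<odot>\<^bsub>A\<^esub> \<one>\<^bsub>A\<^esub>)"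
    using \<alpha> \<beta> i(1) z by (simp add: A.smult_assoc1 del: A.smult_one)
  then have "?z [^]\<^bsub>A\<^esub> p = \<beta> \<odot>\<^bsub>A\<^esub> \<one>\<^bsub>A\<^esub>"
    using i \<beta> z by simp
  then show ?thesis
    unfolding cyclic_pair_def using x z xp zx by simp
qed

end

section \<open>The three elementary isomorphisms\<close>

context char_p_field
begin

abbreviation cyc :: "'a \<Rightarrow> 'a \<Rightarrow> ('a, (cyc_gen list \<Rightarrow> 'a) set) module" where
  "cyc \<alpha> \<beta> \<equiv> cyclic_alg p F \<alpha> \<beta>"

lemma cyc_algebra: "\<alpha> \<in> carrier F \<Longrightarrow> \<beta> \<in> carrier F \<Longrightarrow> char_p_algebra F p (cyc \<alpha> \<beta>)"
  by (intro char_p_algebra.intro char_p_field_axioms cyclic_algebra.cyclic_alg_algebra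
      cyclic_algebraI)

text \<open>Translation by \<open>-c\<close> is the inverse change of generators and restores
  \<open>\<alpha>\<close>, since \<open>c^p - c\<close> is odd in \<open>c\<close>.\<close>

lemma cyc_translate:
  assumes \<alpha>: "\<alpha> \<in> carrier F" and \<beta>: "\<beta> \<in> carrier F" and c: "c \<in> carrier F"
  shows "alg_iso F (cyc \<alpha> \<beta>) (cyc (\<alpha> \<oplus>\<^bsub>F\<^esub> (c [^]\<^bsub>F\<^esub> p \<ominus>\<^bsub>F\<^esub> c)) \<beta>)"
proof -
  let ?\<alpha> = "\<alpha> \<oplus>\<^bsub>F\<^esub> (c [^]\<^bsub>F\<^esub> p \<ominus>\<^bsub>F\<^esub> c)"
  have \<alpha>': "?\<alpha> \<in> carrier F" using \<alpha> c by simp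
  interpret C: cyclic_algebra p F \<alpha> \<beta> using \<alpha> \<beta> by (rule cyclic_algebraI)
  interpret D: cyclic_algebra p F ?\<alpha> \<beta> using \<alpha>' \<beta> by (rule cyclic_algebraI)
  let ?x' = "C.gi \<oplus>\<^bsub>C.C\<^esub> c \<odot>\<^bsub>C.C\<^esub> \<one>\<^bsub>C.C\<^esub>"
  let ?x = "D.gi \<oplus>\<^bsub>D.C\<^esub> (\<ominus>\<^bsub>F\<^esub> c) \<odot>\<^bsub>D.C\<^esub> \<one>\<^bsub>D.C\<^esub>"
  have gC: "C.gi \<in> carrier C.C" and gD: "D.gi \<in> carrier D.C"
    using C.pair_gens D.pair_gens by (auto simp: cyclic_pair_def)
  show ?thesis
  proof (rule cyclic_alg_isoI[OF C.cyclic_algebra_axioms D.cyclic_algebra_axioms])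
    show "cyclic_pair p F C.C ?\<alpha> \<beta> ?x' C.gj"
      using char_p_algebra.pair_translate[OF cyc_algebra[OF \<alpha> \<beta>] C.pair_gens c \<alpha>] .
    have "?\<alpha> \<oplus>\<^bsub>F\<^esub> ((\<ominus>\<^bsub>F\<^esub> c) [^]\<^bsub>F\<^esub> p \<ominus>\<^bsub>F\<^esub> (\<ominus>\<^bsub>F\<^esub> c)) = \<alpha>"
      using \<alpha> c by (simp add: neg_pow_p a_minus_def a_ac r_neg1 r_neg2 l_neg r_neg)
    then show "cyclic_pair p F D.C \<alpha> \<beta> ?x D.gj"
      using char_p_algebra.pair_translate[OF cyc_algebra[OF \<alpha>' \<beta>] D.pair_gens _ \<alpha>', of "\<ominus>\<^bsub>F\<^esub> c"] c
      by simp
  next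
    fix h assume h: "h \<in> alg_hom F D.C C.C" "h D.gi = ?x'" "h D.gj = C.gj"
    show "h ?x = C.gi \<and> h D.gj = C.gj"
      using gC gD c by (simp add: alg_homD[OF h(1)] h(2,3) C.C.a_assoc C.C.smult_l_minus C.C.r_neg)
  next
    fix g assume g: "g \<in> alg_hom F C.C D.C" "g C.gi = ?x" "g C.gj = D.gj"
    show "g ?x' = D.gi \<and> g C.gj = D.gj"
      using gC gD c by (simp add: alg_homD[OF g(1)] g(2,3) D.C.a_assoc D.C.smult_l_minus D.C.l_neg)
  qed
qed

text \<open>The second generator is fixed, so replacing \<open>c\<close> by \<open>-c\<close> undoes
  the change.\<close>

lemma cyc_add:
  assumes \<alpha>: "\<alpha> \<in> carrier F" and \<beta>: "\<beta> \<in> carrier F" and c: "c \<in> carrier F"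
  shows "alg_iso F (cyc \<alpha> \<beta>) (cyc (\<alpha> \<oplus>\<^bsub>F\<^esub> c [^]\<^bsub>F\<^esub> p \<otimes>\<^bsub>F\<^esub> \<beta> [^]\<^bsub>F\<^esub> (p - 1)) \<beta>)"
proof -
  let ?\<alpha> = "\<alpha> \<oplus>\<^bsub>F\<^esub> c [^]\<^bsub>F\<^esub> p \<otimes>\<^bsub>F\<^esub> \<beta> [^]\<^bsub>F\<^esub> (p - 1)"
  have \<alpha>': "?\<alpha> \<in> carrier F" using \<alpha> \<beta> c by simp
  interpret C: cyclic_algebra p F \<alpha> \<beta> using \<alpha> \<beta> by (rule cyclic_algebraI)
  interpret D: cyclic_algebra p F ?\<alpha> \<beta> using \<alpha>' \<beta> by (rule cyclic_algebraI)
  let ?x' = "C.gi \<oplus>\<^bsub>C.C\<^esub> c \<odot>\<^bsub>C.C\<^esub> C.gj [^]\<^bsub>C.C\<^esub> (p - 1)"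
  let ?x = "D.gi \<oplus>\<^bsub>D.C\<^esub> (\<ominus>\<^bsub>F\<^esub> c) \<odot>\<^bsub>D.C\<^esub> D.gj [^]\<^bsub>D.C\<^esub> (p - 1)"
  have gC: "C.gi \<in> carrier C.C" "C.gj \<in> carrier C.C"
    and gD: "D.gi \<in> carrier D.C" "D.gj \<in> carrier D.C"
    using C.pair_gens D.pair_gens by (auto simp: cyclic_pair_def)
  show ?thesis
  proof (rule cyclic_alg_isoI[OF C.cyclic_algebra_axioms D.cyclic_algebra_axioms])
    show "cyclic_pair p F C.C ?\<alpha> \<beta> ?x' C.gj"
      using char_p_algebra.pair_add[OF cyc_algebra[OF \<alpha> \<beta>] C.pair_gens c \<alpha> \<beta>] .
    have "?\<alpha> \<oplus>\<^bsub>F\<^esub> (\<ominus>\<^bsub>F\<^esub> c) [^]\<^bsub>F\<^esub> p \<otimes>\<^bsub>F\<^esub> \<beta> [^]\<^bsub>F\<^esub> (p - 1) = \<alpha>"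
      using \<alpha> \<beta> c by (simp add: neg_pow_p l_minus a_assoc r_neg)
    then show "cyclic_pair p F D.C \<alpha> \<beta> ?x D.gj"
      using char_p_algebra.pair_add[OF cyc_algebra[OF \<alpha>' \<beta>] D.pair_gens _ \<alpha>' \<beta>, of "\<ominus>\<^bsub>F\<^esub> c"] c
      by simp
  next
    fix h assume h: "h \<in> alg_hom F D.C C.C" "h D.gi = ?x'" "h D.gj = C.gj"
    show "h ?x = C.gi \<and> h D.gj = C.gj"
      using gC gD c
      by (simp add: alg_homD[OF h(1)] alg_hom_pow[OF D.cyclic_alg_algebra C.cyclic_alg_algebra h(1)]
          h(2,3) C.C.a_assoc C.C.smult_l_minus C.C.r_neg del: One_nat_def)
  next
    fix g assume g: "g \<in> alg_hom F C.C D.C" "g C.gi = ?x" "g C.gj = D.gj"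
    show "g ?x' = D.gi \<and> g C.gj = D.gj"
      using gC gD c
      by (simp add: alg_homD[OF g(1)] alg_hom_pow[OF C.cyclic_alg_algebra D.cyclic_alg_algebra g(1)]
          g(2,3) D.C.a_assoc D.C.smult_l_minus D.C.l_neg del: One_nat_def)
  qed
qed

lemma cyc_mult:
  assumes \<alpha>0: "\<alpha> \<in> carrier F - {\<zero>\<^bsub>F\<^esub>}" and \<beta>: "\<beta> \<in> carrier F"
  shows "alg_iso F (cyc \<alpha> \<beta>) (cyc \<alpha> (\<alpha> \<otimes>\<^bsub>F\<^esub> \<beta>))"
proof -
  have \<alpha>: "\<alpha> \<in> carrier F" using \<alpha>0 by simp
  let ?\<beta> = "\<alpha> \<otimes>\<^bsub>F\<^esub> \<beta>"
  have \<beta>': "?\<beta> \<in> carrier F" using \<alpha> \<beta> by simp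
  interpret C: cyclic_algebra p F \<alpha> \<beta> using \<alpha> \<beta> by (rule cyclic_algebraI)
  interpret D: cyclic_algebra p F \<alpha> ?\<beta> using \<alpha> \<beta>' by (rule cyclic_algebraI)
  interpret CA: char_p_algebra F p C.C using \<alpha> \<beta> by (rule cyc_algebra)
  interpret DA: char_p_algebra F p D.C using \<alpha> \<beta>' by (rule cyc_algebra)
  have gC: "C.gi \<in> carrier C.C" "C.gj \<in> carrier C.C"
      "C.gi [^]\<^bsub>C.C\<^esub> p \<ominus>\<^bsub>C.C\<^esub> C.gi = \<alpha> \<odot>\<^bsub>C.C\<^esub> \<one>\<^bsub>C.C\<^esub>"
    and gD: "D.gi \<in> carrier D.C" "D.gj \<in> carrier D.C"
      "D.gi [^]\<^bsub>D.C\<^esub> p \<ominus>\<^bsub>D.C\<^esub> D.gi = \<alpha> \<odot>\<^bsub>D.C\<^esub> \<one>\<^bsub>D.C\<^esub>"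
    using C.pair_gens D.pair_gens by (auto simp: cyclic_pair_def)
  note uC = CA.as_inv[OF gC(1,3) \<alpha>0] and uD = DA.as_inv[OF gD(1,3) \<alpha>0]
  have i: "inv\<^bsub>F\<^esub> \<alpha> \<in> carrier F" using \<alpha>0 by (auto simp: field_Units)
  show ?thesis
  proof (rule cyclic_alg_isoI[OF C.cyclic_algebra_axioms D.cyclic_algebra_axioms])
    show "cyclic_pair p F C.C \<alpha> ?\<beta> C.gi (C.gi \<otimes>\<^bsub>C.C\<^esub> C.gj)"
      using CA.pair_mult[OF C.pair_gens \<alpha> \<beta>] .
    show "cyclic_pair p F D.C \<alpha> \<beta> D.gi (DA.as_inv \<alpha> D.gi \<otimes>\<^bsub>D.C\<^esub> D.gj)"
      using DA.pair_divide[OF D.pair_gens \<alpha>0 \<beta>] .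
  next
    fix h assume h: "h \<in> alg_hom F D.C C.C" "h D.gi = C.gi" "h D.gj = C.gi \<otimes>\<^bsub>C.C\<^esub> C.gj"
    \<comment> \<open>Both generators \<open>i\<close> correspond, hence so do their inverses, which
      are given by the same polynomial.\<close>
    have "h (DA.as_inv \<alpha> D.gi) = CA.as_inv \<alpha> C.gi"
      using gD i
      by (simp add: DA.as_inv_def CA.as_inv_def alg_homD[OF h(1)] h(2)
          alg_hom_pow[OF D.cyclic_alg_algebra C.cyclic_alg_algebra h(1)]
          alg_hom_minus[OF D.cyclic_alg_algebra C.cyclic_alg_algebra h(1)])
    then show "h D.gi = C.gi \<and> h (DA.as_inv \<alpha> D.gi \<otimes>\<^bsub>D.C\<^esub> D.gj) = C.gj"
      using gC gD uC uD by (simp add: alg_homD[OF h(1)] h(2,3) C.C.m_assoc[symmetric])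
  next
    fix g assume g: "g \<in> alg_hom F C.C D.C" "g C.gi = D.gi"
      "g C.gj = DA.as_inv \<alpha> D.gi \<otimes>\<^bsub>D.C\<^esub> D.gj"
    show "g C.gi = D.gi \<and> g (C.gi \<otimes>\<^bsub>C.C\<^esub> C.gj) = D.gj"
      using gC gD uD by (simp add: alg_homD[OF g(1)] g(2,3) D.C.m_assoc[symmetric])
  qed
qed

end

section \<open>Chains of cyclic \<open>p\<close>-algebras\<close>

context char_p_field
begin

lemma cyc_sym:
  "\<lbrakk>alg_iso F (cyc \<alpha> \<beta>) (cyc \<alpha>' \<beta>'); \<alpha> \<in> carrier F; \<beta> \<in> carrier F\<rbrakk> \<Longrightarrow>
    alg_iso F (cyc \<alpha>' \<beta>') (cyc \<alpha> \<beta>)"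
  by (rule alg_iso_sym[OF _ cyclic_algebra.cyclic_alg_algebra[OF cyclic_algebraI]])

lemma nonzero_inv:
  assumes "\<beta> \<in> carrier F - {\<zero>\<^bsub>F\<^esub>}"
  shows "inv\<^bsub>F\<^esub> \<beta> \<in> carrier F - {\<zero>\<^bsub>F\<^esub>}" "inv\<^bsub>F\<^esub> \<beta> \<otimes>\<^bsub>F\<^esub> \<beta> = \<one>\<^bsub>F\<^esub>"
proof -
  have u: "\<beta> \<in> Units F" using assms by (simp add: field_Units)
  then show "inv\<^bsub>F\<^esub> \<beta> \<otimes>\<^bsub>F\<^esub> \<beta> = \<one>\<^bsub>F\<^esub>" by (rule Units_l_inv)
  show "inv\<^bsub>F\<^esub> \<beta> \<in> carrier F - {\<zero>\<^bsub>F\<^esub>}"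
    using Units_inv_Units[OF u] by (simp add: field_Units)
qed

text \<open>For \<open>c\<close> the inverse of \<open>\<beta>\<close> the increment
  \<open>c^p \<beta>^(p-1)\<close> is again that inverse; this makes the first slot nonzero.\<close>

lemma cyc_zero_inv:
  assumes \<beta>: "\<beta> \<in> carrier F - {\<zero>\<^bsub>F\<^esub>}"
  shows "alg_iso F (cyc \<zero>\<^bsub>F\<^esub> \<beta>) (cyc (inv\<^bsub>F\<^esub> \<beta>) \<beta>)"
proof -
  note i = nonzero_inv[OF \<beta>]
  have p0: "p = Suc (p - 1)" using prime_gt_0_nat[OF prime] by simp
  have "(inv\<^bsub>F\<^esub> \<beta>) [^]\<^bsub>F\<^esub> p \<otimes>\<^bsub>F\<^esub> \<beta> [^]\<^bsub>F\<^esub> (p - 1) =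
      ((inv\<^bsub>F\<^esub> \<beta>) [^]\<^bsub>F\<^esub> (p - 1) \<otimes>\<^bsub>F\<^esub> \<beta> [^]\<^bsub>F\<^esub> (p - 1)) \<otimes>\<^bsub>F\<^esub> inv\<^bsub>F\<^esub> \<beta>"
    using i \<beta> by (subst (1) p0) (simp add: m_ac del: One_nat_def)
  also have "\<dots> = inv\<^bsub>F\<^esub> \<beta>"
    using i \<beta> by (simp add: nat_pow_distrib[symmetric])
  finally show ?thesis
    using cyc_add[of "\<zero>\<^bsub>F\<^esub>" \<beta> "inv\<^bsub>F\<^esub> \<beta>"] i \<beta> by simp
qed

text \<open>With second slot 1 one may add \<open>c^p - c\<close> and also \<open>(-c)^p\<close>;
  together they subtract \<open>c\<close>, so the first slot is arbitrary.\<close>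

lemma cyc_one:
  assumes \<alpha>: "\<alpha> \<in> carrier F" and \<alpha>': "\<alpha>' \<in> carrier F"
  shows "alg_iso F (cyc \<alpha> \<one>\<^bsub>F\<^esub>) (cyc \<alpha>' \<one>\<^bsub>F\<^esub>)"
proof -
  let ?c = "\<alpha> \<ominus>\<^bsub>F\<^esub> \<alpha>'"
  let ?\<gamma> = "\<alpha> \<oplus>\<^bsub>F\<^esub> (?c [^]\<^bsub>F\<^esub> p \<ominus>\<^bsub>F\<^esub> ?c)"
  have c: "?c \<in> carrier F" "?\<gamma> \<in> carrier F" using \<alpha> \<alpha>' by simp_all
  have "?\<gamma> \<oplus>\<^bsub>F\<^esub> (\<ominus>\<^bsub>F\<^esub> ?c) [^]\<^bsub>F\<^esub> p \<otimes>\<^bsub>F\<^esub> \<one>\<^bsub>F\<^esub> [^]\<^bsub>F\<^esub> (p - 1) = \<alpha> \<ominus>\<^bsub>F\<^esub> ?c"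
  proof -
    define d where "d = ?c"
    have "d \<in> carrier F" using c(1) by (simp add: d_def)
    then show ?thesis
      unfolding d_def[symmetric] using \<alpha> by (simp add: neg_pow_p a_minus_def a_ac r_neg1 r_neg2 r_neg)
  qed
  also have "\<dots> = \<alpha>'"
    using \<alpha> \<alpha>' by (simp add: a_minus_def minus_add r_neg2)
  finally have "alg_iso F (cyc ?\<gamma> \<one>\<^bsub>F\<^esub>) (cyc \<alpha>' \<one>\<^bsub>F\<^esub>)"
    using cyc_add[of ?\<gamma> "\<one>\<^bsub>F\<^esub>" "\<ominus>\<^bsub>F\<^esub> ?c"] c by simp
  then show ?thesis
    using cyc_translate[OF \<alpha> _ c(1), of "\<one>\<^bsub>F\<^esub>"] by (auto intro: alg_iso_trans)
qed

text \<open>Both algebras pass through second slot 1: \<open>[0,\<beta>)\<close> has first slot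
  \<open>\<beta>^(-1)\<close> after \<open>cyc_zero_inv\<close>, multiplication by it makes the
  second slot 1, and there \<open>cyc_one\<close> moves the first slot freely.\<close>

lemma cyc_zero:
  assumes \<beta>: "\<beta> \<in> carrier F - {\<zero>\<^bsub>F\<^esub>}" and \<beta>': "\<beta>' \<in> carrier F - {\<zero>\<^bsub>F\<^esub>}"
  shows "alg_iso F (cyc \<zero>\<^bsub>F\<^esub> \<beta>) (cyc \<zero>\<^bsub>F\<^esub> \<beta>')"
proof -
  have one: "alg_iso F (cyc \<zero>\<^bsub>F\<^esub> \<gamma>) (cyc (inv\<^bsub>F\<^esub> \<gamma>) \<one>\<^bsub>F\<^esub>)" if \<gamma>: "\<gamma> \<in> carrier F - {\<zero>\<^bsub>F\<^esub>}" for \<gamma>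
    using alg_iso_trans[OF cyc_zero_inv[OF \<gamma>] cyc_mult[of "inv\<^bsub>F\<^esub> \<gamma>" \<gamma>]] nonzero_inv[OF \<gamma>] \<gamma>
    by simp
  have "alg_iso F (cyc \<zero>\<^bsub>F\<^esub> \<beta>) (cyc (inv\<^bsub>F\<^esub> \<beta>') \<one>\<^bsub>F\<^esub>)"
    using alg_iso_trans[OF one[OF \<beta>] cyc_one] nonzero_inv(1)[OF \<beta>] nonzero_inv(1)[OF \<beta>'] by simp
  moreover have "alg_iso F (cyc (inv\<^bsub>F\<^esub> \<beta>') \<one>\<^bsub>F\<^esub>) (cyc \<zero>\<^bsub>F\<^esub> \<beta>')"
    using cyc_sym[OF one[OF \<beta>']] \<beta>' by simp
  ultimately show ?thesis by (rule alg_iso_trans)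
qed

text \<open>The arbitrary \<open>b\<close> lets \<open>a'\<close> replace \<open>a\<close> at the
  head of a chain without touching the rest of it.\<close>

lemma cyc_link:
  assumes \<gamma>: "\<gamma> \<in> carrier F" and \<delta>: "\<delta> \<in> carrier F - {\<zero>\<^bsub>F\<^esub>}" and a: "a \<in> carrier F - {\<zero>\<^bsub>F\<^esub>}"
  obtains \<gamma>' a' where "\<gamma>' \<in> carrier F - {\<zero>\<^bsub>F\<^esub>}" "a' \<in> carrier F - {\<zero>\<^bsub>F\<^esub>}"
    "alg_iso F (cyc \<gamma> \<delta>) (cyc \<gamma>' a')"
    "\<And>b. b \<in> carrier F \<Longrightarrow> alg_iso F (cyc a b) (cyc a' b)"
proof -
  note i = nonzero_inv[OF \<delta>]
  have carr: "\<gamma> \<in> carrier F" "\<delta> \<in> carrier F" "a \<in> carrier F" "inv\<^bsub>F\<^esub> \<delta> \<in> carrier F"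
    using \<gamma> \<delta> a i by auto
  \<comment> \<open>The value is forced: with \<open>e = c \<delta>\<close> the new second slot is
    \<open>\<gamma> \<delta> + e^p\<close> and the new head is \<open>a + e^p - e\<close>, which
    agree exactly for this \<open>e\<close>.\<close>
  define e where "e = a \<ominus>\<^bsub>F\<^esub> \<delta> \<otimes>\<^bsub>F\<^esub> \<gamma>"
  define c where "c = e \<otimes>\<^bsub>F\<^esub> inv\<^bsub>F\<^esub> \<delta>"
  define \<gamma>' where "\<gamma>' = \<gamma> \<oplus>\<^bsub>F\<^esub> c [^]\<^bsub>F\<^esub> p \<otimes>\<^bsub>F\<^esub> \<delta> [^]\<^bsub>F\<^esub> (p - 1)"
  have e: "e \<in> carrier F" and c: "c \<in> carrier F" and \<gamma>'c: "\<gamma>' \<in> carrier F"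
    using carr by (simp_all add: e_def c_def \<gamma>'_def)
  have iso: "alg_iso F (cyc \<gamma> \<delta>) (cyc \<gamma>' \<delta>)"
    unfolding \<gamma>'_def using carr c by (intro cyc_add)
  show ?thesis
  proof (cases "\<gamma>' = \<zero>\<^bsub>F\<^esub>")
    case True
    \<comment> \<open>A zero first slot rules out multiplication by it. But
      \<open>[0,\<delta>)\<close> may be exchanged for \<open>[0,a)\<close>, so here the head
      \<open>a\<close> stays as it is.\<close>
    then have "alg_iso F (cyc \<gamma> \<delta>) (cyc (inv\<^bsub>F\<^esub> a) a)"
      using iso cyc_zero[OF \<delta> a] cyc_zero_inv[OF a] by (metis alg_iso_trans)
    then show ?thesis
      using that[of "inv\<^bsub>F\<^esub> a" a] nonzero_inv(1)[OF a] a alg_iso_refl by blast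
  next
    case False
    have p0: "p = Suc (p - 1)" using prime_gt_0_nat[OF prime] by simp
    have "c [^]\<^bsub>F\<^esub> p \<otimes>\<^bsub>F\<^esub> \<delta> [^]\<^bsub>F\<^esub> (p - 1) \<otimes>\<^bsub>F\<^esub> \<delta> = c [^]\<^bsub>F\<^esub> p \<otimes>\<^bsub>F\<^esub> \<delta> [^]\<^bsub>F\<^esub> p"
      using carr c by (subst (4) p0) (simp add: m_assoc del: One_nat_def)
    also have "\<dots> = (c \<otimes>\<^bsub>F\<^esub> \<delta>) [^]\<^bsub>F\<^esub> p"
      using carr c by (simp add: nat_pow_distrib)
    also have "c \<otimes>\<^bsub>F\<^esub> \<delta> = e"
      using carr e i by (simp add: c_def m_assoc)
    finally have "\<gamma>' \<otimes>\<^bsub>F\<^esub> \<delta> = \<gamma> \<otimes>\<^bsub>F\<^esub> \<delta> \<oplus>\<^bsub>F\<^esub> e [^]\<^bsub>F\<^esub> p"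
      using carr c by (simp add: \<gamma>'_def l_distr)
    also have "\<gamma> \<otimes>\<^bsub>F\<^esub> \<delta> = a \<ominus>\<^bsub>F\<^esub> e"
      using carr by (simp add: e_def a_minus_def minus_add r_neg2 r_neg1 m_comm)
    also have "(a \<ominus>\<^bsub>F\<^esub> e) \<oplus>\<^bsub>F\<^esub> e [^]\<^bsub>F\<^esub> p = a \<oplus>\<^bsub>F\<^esub> (e [^]\<^bsub>F\<^esub> p \<ominus>\<^bsub>F\<^esub> e)"
      using carr e by (simp add: a_minus_def a_ac)
    finally have \<gamma>'\<delta>: "\<gamma>' \<otimes>\<^bsub>F\<^esub> \<delta> = a \<oplus>\<^bsub>F\<^esub> (e [^]\<^bsub>F\<^esub> p \<ominus>\<^bsub>F\<^esub> e)" .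
    show ?thesis
    proof (rule that[of \<gamma>' "\<gamma>' \<otimes>\<^bsub>F\<^esub> \<delta>"])
      show "\<gamma>' \<in> carrier F - {\<zero>\<^bsub>F\<^esub>}" using False \<gamma>'c by simp
      show "\<gamma>' \<otimes>\<^bsub>F\<^esub> \<delta> \<in> carrier F - {\<zero>\<^bsub>F\<^esub>}"
        using False \<gamma>'c \<delta> by (auto simp: integral_iff)
      show "alg_iso F (cyc \<gamma> \<delta>) (cyc \<gamma>' (\<gamma>' \<otimes>\<^bsub>F\<^esub> \<delta>))"
        using iso cyc_mult[of \<gamma>' \<delta>] False \<gamma>'c carr by (auto intro: alg_iso_trans)
      show "alg_iso F (cyc a b) (cyc (\<gamma>' \<otimes>\<^bsub>F\<^esub> \<delta>) b)" if "b \<in> carrier F" for b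
        unfolding \<gamma>'\<delta> using carr that e by (intro cyc_translate)
    qed
  qed
qed

text \<open>The n + 1 algebras with indices 0 to n need n + 2 entries. The induction step adjusts
  just one isomorphism of the tail, the one containing its head.\<close>

lemma cyc_chain:
  assumes "\<And>k. k \<le> n \<Longrightarrow> \<alpha> k \<in> carrier F" "\<And>k. k \<le> n \<Longrightarrow> \<beta> k \<in> carrier F - {\<zero>\<^bsub>F\<^esub>}"
  shows "\<exists>a. (\<forall>k\<le>Suc n. a k \<in> carrier F - {\<zero>\<^bsub>F\<^esub>}) \<and>
    (\<forall>k\<le>n. alg_iso F (cyc (\<alpha> k) (\<beta> k)) (cyc (a k) (a (Suc k))))"
  using assms
proof (induction n arbitrary: \<alpha> \<beta>)
  case 0
  then have \<alpha>: "\<alpha> 0 \<in> carrier F" and \<beta>: "\<beta> 0 \<in> carrier F - {\<zero>\<^bsub>F\<^esub>}" by auto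
  \<comment> \<open>For a single algebra only a zero first slot has to be removed.\<close>
  obtain \<gamma> where "\<gamma> \<in> carrier F - {\<zero>\<^bsub>F\<^esub>}" "alg_iso F (cyc (\<alpha> 0) (\<beta> 0)) (cyc \<gamma> (\<beta> 0))"
    using \<alpha> cyc_zero_inv[OF \<beta>] nonzero_inv(1)[OF \<beta>] alg_iso_refl by (cases "\<alpha> 0 = \<zero>\<^bsub>F\<^esub>") auto
  then show ?case
    using \<beta> by (intro exI[of _ "case_nat \<gamma> (\<lambda>_. \<beta> 0)"]) (auto split: nat.split)
next
  case (Suc n)
  have "\<exists>a. (\<forall>k\<le>Suc n. a k \<in> carrier F - {\<zero>\<^bsub>F\<^esub>}) \<and>
    (\<forall>k\<le>n. alg_iso F (cyc (\<alpha> (Suc k)) (\<beta> (Suc k))) (cyc (a k) (a (Suc k))))"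
    by (rule Suc.IH) (use Suc.prems in auto)
  then obtain a where a: "\<And>k. k \<le> Suc n \<Longrightarrow> a k \<in> carrier F - {\<zero>\<^bsub>F\<^esub>}"
    and iso: "\<And>k. k \<le> n \<Longrightarrow> alg_iso F (cyc (\<alpha> (Suc k)) (\<beta> (Suc k))) (cyc (a k) (a (Suc k)))"
    by blast
  have "\<alpha> 0 \<in> carrier F" "\<beta> 0 \<in> carrier F - {\<zero>\<^bsub>F\<^esub>}" "a 0 \<in> carrier F - {\<zero>\<^bsub>F\<^esub>}"
    using Suc.prems(1)[of 0] Suc.prems(2)[of 0] a[of 0] by simp_all
  then obtain \<gamma> a' where \<gamma>: "\<gamma> \<in> carrier F - {\<zero>\<^bsub>F\<^esub>}" and a': "a' \<in> carrier F - {\<zero>\<^bsub>F\<^esub>}"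
    and iso0: "alg_iso F (cyc (\<alpha> 0) (\<beta> 0)) (cyc \<gamma> a')"
    and iso1: "\<And>b. b \<in> carrier F \<Longrightarrow> alg_iso F (cyc (a 0) b) (cyc a' b)"
    by (rule cyc_link) blast
  \<comment> \<open>The new sequence is \<open>\<gamma>, a', a 1, a 2, ...\<close>: the old head
    \<open>a 0\<close> is discarded in favour of \<open>a'\<close>.\<close>
  define s where "s k = (case k of 0 \<Rightarrow> \<gamma> | Suc 0 \<Rightarrow> a' | Suc (Suc j) \<Rightarrow> a (Suc j))" for k
  have s: "s 0 = \<gamma>" "s (Suc 0) = a'" "s (Suc (Suc j)) = a (Suc j)" for j
    by (simp_all add: s_def)
  have "s k \<in> carrier F - {\<zero>\<^bsub>F\<^esub>}" if "k \<le> Suc (Suc n)" for k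
    using that \<gamma> a' a by (auto simp: s_def split: nat.split)
  moreover have "alg_iso F (cyc (\<alpha> k) (\<beta> k)) (cyc (s k) (s (Suc k)))" if k: "k \<le> Suc n" for k
  proof -
    consider "k = 0" | "k = Suc 0" | j where "k = Suc (Suc j)"
      by (metis not0_implies_Suc)
    then show ?thesis
    proof cases
      case 1
      then show ?thesis using iso0 by (simp add: s)
    next
      case 2
      \<comment> \<open>The first factor of the tail is the one whose head changes from
        \<open>a 0\<close> to \<open>a'\<close>.\<close>
      have "alg_iso F (cyc (a 0) (a (Suc 0))) (cyc a' (a (Suc 0)))"
        using a[of "Suc 0"] by (intro iso1) auto
      then show ?thesis using 2 alg_iso_trans[OF iso[of 0]] by (simp add: s)
    next
      case 3
      then show ?thesis using iso[of "Suc j"] k by (simp add: s)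
    qed
  qed
  ultimately show ?case by blast
qed

end

theorem corollary2p3:
  fixes F :: "('f, 'm) ring_scheme"
    and A :: "('f, 'a, 'k) module_scheme"
    and B :: "nat \<Rightarrow> ('f, 'b, 'l) module_scheme"
    and p n :: nat
  assumes "Factorial_Ring.prime p"
    and "field F"
    and "ring_char F = p"
    and "n \<ge> 1"
    and "\<And>k. k < n \<Longrightarrow> cyclic_p_algebra p F (B k)"
    and "assoc_algebra F A"
    and "alg_iso F A (tensor_alg F {..<n} B)"
  shows "\<exists>a. (\<forall>k\<le>n. a k \<in> carrier F - {\<zero>\<^bsub>F\<^esub>}) \<and>
           alg_iso F A (tensor_alg F {..<n} (\<lambda>k. cyclic_alg p F (a k) (a (Suc k))))"
proof -
  interpret field F by fact
  \<comment> \<open>The characteristic is the additive order of 1, and that multiple of 1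
    vanishes.\<close>
  have "[p] \<cdot>\<^bsub>F\<^esub> \<one>\<^bsub>F\<^esub> = \<zero>\<^bsub>F\<^esub>"
    unfolding assms(3)[symmetric] ring_char_def by (rule add.pow_ord_eq_1) simp
  then interpret char_p_field F p
    using assms(1) by unfold_locales
  \<comment> \<open>\<open>cyc_chain\<close> is indexed by the last factor, not by the number of
    factors.\<close>
  obtain m where n: "n = Suc m" using assms(4) by (cases n) auto
  have B: "assoc_algebra F (B k) \<and> (\<exists>\<alpha>\<in>carrier F. \<exists>\<beta>\<in>carrier F - {\<zero>\<^bsub>F\<^esub>}. alg_iso F (B k) (cyc \<alpha> \<beta>))"
    if "k < n" for k
    using assms(5)[OF that] by (simp add: cyclic_p_algebra_def)
  then obtain \<alpha> \<beta> where \<alpha>: "\<And>k. k < n \<Longrightarrow> \<alpha> k \<in> carrier F"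
    and \<beta>: "\<And>k. k < n \<Longrightarrow> \<beta> k \<in> carrier F - {\<zero>\<^bsub>F\<^esub>}"
    and iso: "\<And>k. k < n \<Longrightarrow> alg_iso F (B k) (cyc (\<alpha> k) (\<beta> k))"
    by metis
  have "\<exists>a. (\<forall>k\<le>Suc m. a k \<in> carrier F - {\<zero>\<^bsub>F\<^esub>}) \<and>
      (\<forall>k\<le>m. alg_iso F (cyc (\<alpha> k) (\<beta> k)) (cyc (a k) (a (Suc k))))"
    using \<alpha> \<beta> n by (intro cyc_chain) auto
  then obtain a where a: "\<forall>k\<le>n. a k \<in> carrier F - {\<zero>\<^bsub>F\<^esub>}"
    and aiso: "\<And>k. k < n \<Longrightarrow> alg_iso F (cyc (\<alpha> k) (\<beta> k)) (cyc (a k) (a (Suc k)))"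
    using n by (auto simp: less_Suc_eq_le)
  have "alg_iso F (tensor_alg F {..<n} B) (tensor_alg F {..<n} (\<lambda>k. cyc (a k) (a (Suc k))))"
  proof (rule tensor_alg_cong)
    show "algebra_family F {..<n} B"
      using B by (intro algebra_family.intro is_cring) auto
    show "algebra_family F {..<n} (\<lambda>k. cyc (a k) (a (Suc k)))"
      using a by (intro algebra_family.intro is_cring cyclic_algebra.cyclic_alg_algebra
          cyclic_algebraI) auto
    show "alg_iso F (B k) (cyc (a k) (a (Suc k)))" if "k \<in> {..<n}" for k
      using that alg_iso_trans[OF iso aiso] by simp
  qed
  with a show ?thesis
    using alg_iso_trans[OF assms(7)] by blast
qed

end
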